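(* Let $M,N,P$ be smooth manifolds, $p\in P$, $h:M\to P$ a smooth map, and consider the completely high index SDAE $$\mathbf{d}X_t = \Big[V(X_t,U_t) + \tfrac12 \sum_{l=1}^d {}^MG(\sigma_l(X_t))\Big]dt + \sum_{l=1}^d \sigma_l(X_t)\,dW^l_t,\qquad h(X_t)=p .$$ Suppose the SDAE is ill-posed, i.e. the vector fields $\sigma_1,\dots,\sigma_d\in\mathfrak{X}(M)$ do not depend on the algebraic variable $u\in N$, and for every $x\in M$ at least one of the vectors satisfies $\sigma_l(x)\notin \mathrm{Ker}(D_xh)$. Then the SDAE has no solution: there is no semi-martingale $(X_t,U_t)\in M\times N$ satisfying both the SDE and the constraint.
   Context: $W_t=(W^1_t,\dots,W^d_t)$ is a $d$-dimensional Wiener process; $\mathfrak{X}(M)$ is the set of smooth vector fields on $M$. $V:M\times N\to TM$ is such that $V(x,u)\in T_xM$. The diffusion space $\mathfrak{D}_xM$ is the space of second order differential operators at $x$ without constant term, locally $L=a^i\partial_i+b^{ij}\partial^2_{ij}$ ($b$ symmetric); $\hat L=b^{ij}\partial_i\otimes\partial_j$ is its symmetric part; $\mathfrak{D}M$ is the bundle of these spaces. A diffusion generator on $M$ is a fiber preserving map ${}^MG:TM\to\mathfrak{D}M$ (over the identity) with $\widehat{{}^MG(Y)}=Y\otimes Y$ for all $Y\in TM$. The intrinsic SDE $\mathbf{d}X_t=[V+\tfrac12\sum_l {}^MG(\sigma_l)]dt+\sum_l\sigma_l\,dW^l_t$ means that for every smooth $f:M\to\mathbb{R}$, $f(X_t)=f(X_0)+\int_0^t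 (V+\tfrac12\sum_l {}^MG(\sigma_l))[f]\,ds+\sum_l\int_0^t\sigma_l[f]\,dW^l_s$ (Itô integrals), with coefficients evaluated along the process. A solution of the SDAE is a semi-martingale $(X_t,U_t)\in M\times N$ satisfying both the SDE and the constraint $h(X_t)=p$. "Completely high index" means that $h$ is not a function of the algebraic variable $u$. *)

theory Defs
  imports "HOL-Probability.Probability"
begin

text \<open>
  \<open>\<real>\<^sup>n\<close> is \<^const>\<open>Euclidean_space\<close> \<open>n\<close>, i.e. the sequences vanishing from index \<open>n\<close> on.  Unlike the
  class \<^class>\<open>euclidean_space\<close>, this admits dimension \<open>0\<close>.
\<close>

definition partial_deriv :: "nat \<Rightarrow> ((nat \<Rightarrow> real) \<Rightarrow> real) \<Rightarrow> (nat \<Rightarrow> real) \<Rightarrow> real" where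
  "partial_deriv i f x = deriv (\<lambda>s. f (x(i := s))) (x i)"

primrec Ck_on :: "nat \<Rightarrow> nat \<Rightarrow> (nat \<Rightarrow> real) set \<Rightarrow> ((nat \<Rightarrow> real) \<Rightarrow> real) \<Rightarrow> bool" where
  "Ck_on n 0 S f \<longleftrightarrow> continuous_map (subtopology (Euclidean_space n) S) euclideanreal f"
| "Ck_on n (Suc k) S f \<longleftrightarrow>
     continuous_map (subtopology (Euclidean_space n) S) euclideanreal f \<and>
     (\<forall>i<n. (\<forall>x\<in>S. (\<lambda>s. f (x(i := s))) differentiable at (x i)) \<and>
            Ck_on n k S (partial_deriv i f))"

definition smooth_on :: "nat \<Rightarrow> (nat \<Rightarrow> real) set \<Rightarrow> ((nat \<Rightarrow> real) \<Rightarrow> real) \<Rightarrow> bool" where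
  "smooth_on n S f \<longleftrightarrow> (\<forall>k. Ck_on n k S f)"

record 'a mfd =
  mtop :: "'a topology"
  mdim :: nat
  charts :: "('a set \<times> ('a \<Rightarrow> nat \<Rightarrow> real)) set"

abbreviation points :: "'a mfd \<Rightarrow> 'a set" where
  "points M \<equiv> topspace (mtop M)"

definition is_chart :: "'a mfd \<Rightarrow> 'a set \<Rightarrow> ('a \<Rightarrow> nat \<Rightarrow> real) \<Rightarrow> bool" where
  "is_chart M U \<phi> \<longleftrightarrow>
     openin (mtop M) U \<and> openin (Euclidean_space (mdim M)) (\<phi> ` U) \<and>
     homeomorphic_map (subtopology (mtop M) U)
       (subtopology (Euclidean_space (mdim M)) (\<phi> ` U)) \<phi>"

definition smooth_manifold :: "'a mfd \<Rightarrow> bool" where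
  "smooth_manifold M \<longleftrightarrow>
     Hausdorff_space (mtop M) \<and> second_countable (mtop M) \<and>
     (\<forall>(U, \<phi>) \<in> charts M. is_chart M U \<phi>) \<and>
     (\<Union>(U, \<phi>) \<in> charts M. U) = points M \<and>
     (\<forall>(U, \<phi>) \<in> charts M. \<forall>(U', \<phi>') \<in> charts M. \<forall>i < mdim M.
        smooth_on (mdim M) (\<phi> ` (U \<inter> U')) (\<lambda>y. \<phi>' (inv_into U \<phi> y) i))"

definition smooth_funs :: "'a mfd \<Rightarrow> ('a \<Rightarrow> real) set" where
  "smooth_funs M =
     {f. \<forall>(U, \<phi>) \<in> charts M. smooth_on (mdim M) (\<phi> ` U) (\<lambda>y. f (inv_into U \<phi> y))}"

definition smooth_map :: "'a mfd \<Rightarrow> 'b mfd \<Rightarrow> ('a \<Rightarrow> 'b) \<Rightarrow> bool" where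
  "smooth_map M P h \<longleftrightarrow>
     continuous_map (mtop M) (mtop P) h \<and>
     (\<forall>(U, \<phi>) \<in> charts M. \<forall>(U', \<psi>) \<in> charts P. \<forall>i < mdim P.
        smooth_on (mdim M) (\<phi> ` (U \<inter> h -` U')) (\<lambda>y. \<psi> (h (inv_into U \<phi> y)) i))"

definition prod_mfd :: "'a mfd \<Rightarrow> 'b mfd \<Rightarrow> ('a \<times> 'b) mfd" where
  "prod_mfd M N =
     \<lparr>mtop = prod_topology (mtop M) (mtop N),
      mdim = mdim M + mdim N,
      charts = {(U \<times> U', \<lambda>(x, u) i. if i < mdim M then \<phi> x i else \<psi> u (i - mdim M)) |
                  U \<phi> U' \<psi>. (U, \<phi>) \<in> charts M \<and> (U', \<psi>) \<in> charts N}\<rparr>"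

text \<open>
  A differential operator at a point is a functional on smooth functions.  Since HOL functions are
  total, it is set to \<open>0\<close> on functions that are not smooth, which makes equality of operators
  coincide with equality on smooth functions.
\<close>

type_synonym 'a pt_op = "('a \<Rightarrow> real) \<Rightarrow> real"

definition tangent_space :: "'a mfd \<Rightarrow> 'a \<Rightarrow> 'a pt_op set" where
  "tangent_space M x =
     {v. (\<forall>f\<in>smooth_funs M. \<forall>g\<in>smooth_funs M. v (\<lambda>y. f y + g y) = v f + v g) \<and>
         (\<forall>c. \<forall>f\<in>smooth_funs M. v (\<lambda>y. c * f y) = c * v f) \<and>
         (\<forall>f\<in>smooth_funs M. \<forall>g\<in>smooth_funs M. v (\<lambda>y. f y * g y) = f x * v g + g x * v f) \<and>
         (\<forall>f. f \<notin> smooth_funs M \<longrightarrow> v f = 0)}"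

definition vector_fields :: "'a mfd \<Rightarrow> ('a \<Rightarrow> 'a pt_op) set" where
  "vector_fields M =
     {Y. (\<forall>x\<in>points M. Y x \<in> tangent_space M x) \<and>
         (\<forall>f\<in>smooth_funs M. (\<lambda>x. Y x f) \<in> smooth_funs M)}"

definition tangent_map :: "'a mfd \<Rightarrow> 'b mfd \<Rightarrow> ('a \<Rightarrow> 'b) \<Rightarrow> 'a pt_op \<Rightarrow> 'b pt_op" where
  "tangent_map M P h v = (\<lambda>g. if g \<in> smooth_funs P then v (\<lambda>y. g (h y)) else 0)"

definition tangent_ker :: "'a mfd \<Rightarrow> 'b mfd \<Rightarrow> ('a \<Rightarrow> 'b) \<Rightarrow> 'a \<Rightarrow> 'a pt_op set" where
  "tangent_ker M P h x = {v \<in> tangent_space M x. tangent_map M P h v = (\<lambda>g. 0)}"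

text \<open>
  \<open>local_form M x U \<phi> a b L\<close>: in the chart \<open>(U, \<phi>)\<close> around \<open>x\<close>, \<open>L = a\<^sup>i \<partial>\<^sub>i + b\<^sup>i\<^sup>j \<partial>\<^sub>i \<partial>\<^sub>j\<close>
  with \<open>b\<close> symmetric.
\<close>

definition local_form ::
  "'a mfd \<Rightarrow> 'a \<Rightarrow> 'a set \<Rightarrow> ('a \<Rightarrow> nat \<Rightarrow> real) \<Rightarrow> (nat \<Rightarrow> real) \<Rightarrow> (nat \<Rightarrow> nat \<Rightarrow> real)
     \<Rightarrow> 'a pt_op \<Rightarrow> bool" where
  "local_form M x U \<phi> a b L \<longleftrightarrow>
     (U, \<phi>) \<in> charts M \<and> x \<in> U \<and>
     (\<forall>i < mdim M. \<forall>j < mdim M. b i j = b j i) \<and>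
     (\<forall>f\<in>smooth_funs M. L f =
        (\<Sum>i < mdim M. a i * partial_deriv i (\<lambda>y. f (inv_into U \<phi> y)) (\<phi> x)) +
        (\<Sum>i < mdim M. \<Sum>j < mdim M.
           b i j * partial_deriv i (partial_deriv j (\<lambda>y. f (inv_into U \<phi> y))) (\<phi> x)))"

definition diffusion_space :: "'a mfd \<Rightarrow> 'a \<Rightarrow> 'a pt_op set" where
  "diffusion_space M x =
     {L. (\<exists>U \<phi> a b. local_form M x U \<phi> a b L) \<and> (\<forall>f. f \<notin> smooth_funs M \<longrightarrow> L f = 0)}"

text \<open>
  An element of \<open>T\<^sub>xM \<otimes> T\<^sub>xM\<close> is represented by the bilinear operator it induces on pairs of
  functions, \<open>(Y \<otimes> Z) (f, g) = Y f * Z g\<close>; this representation is faithful.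
\<close>

definition vec_tensor :: "'a pt_op \<Rightarrow> 'a pt_op \<Rightarrow> ('a \<Rightarrow> real) \<Rightarrow> ('a \<Rightarrow> real) \<Rightarrow> real" where
  "vec_tensor Y Z = (\<lambda>f g. Y f * Z g)"

text \<open>
  The symmetric part \<open>b\<^sup>i\<^sup>j \<partial>\<^sub>i \<otimes> \<partial>\<^sub>j\<close> of \<open>L\<close>, as a relation.  The coefficients \<open>b\<close> are determined by
  \<open>L\<close> and the chart, and they transform as a tensor, so the existential chart is immaterial.
\<close>

definition has_symmetric_part ::
  "'a mfd \<Rightarrow> 'a \<Rightarrow> 'a pt_op \<Rightarrow> (('a \<Rightarrow> real) \<Rightarrow> ('a \<Rightarrow> real) \<Rightarrow> real) \<Rightarrow> bool" where
  "has_symmetric_part M x L T \<longleftrightarrow>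
     (\<exists>U \<phi> a b. local_form M x U \<phi> a b L \<and>
        T = (\<lambda>f g. if f \<in> smooth_funs M \<and> g \<in> smooth_funs M then
               (\<Sum>i < mdim M. \<Sum>j < mdim M. b i j *
                  (partial_deriv i (\<lambda>y. f (inv_into U \<phi> y)) (\<phi> x) *
                   partial_deriv j (\<lambda>y. g (inv_into U \<phi> y)) (\<phi> x)))
             else 0))"

text \<open>
  A fibre preserving map \<open>TM \<rightarrow> \<DD>M\<close> over the identity is a family of maps between the fibres.  The
  base point has to be an explicit argument because, e.g., the zero operator lies in every fibre.
\<close>

definition diffusion_generator :: "'a mfd \<Rightarrow> ('a \<Rightarrow> 'a pt_op \<Rightarrow> 'a pt_op) \<Rightarrow> bool" where
  "diffusion_generator M G \<longleftrightarrow>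
     (\<forall>x\<in>points M. \<forall>Y\<in>tangent_space M x.
        G x Y \<in> diffusion_space M x \<and> has_symmetric_part M x (G x Y) (vec_tensor Y Y))"

text \<open>
  Time is \<open>[0, \<infinity>)\<close>, embedded in \<^typ>\<open>real\<close>; no condition refers to processes at negative times.
  Filtrations are not assumed complete or right-continuous.
\<close>

definition filtered_prob_space :: "'w measure \<Rightarrow> (real \<Rightarrow> 'w measure) \<Rightarrow> bool" where
  "filtered_prob_space \<mu> F \<longleftrightarrow>
     prob_space \<mu> \<and> filtration (space \<mu>) F \<and> (\<forall>t. subalgebra \<mu> (F t))"

definition adapted :: "(real \<Rightarrow> 'w measure) \<Rightarrow> (real \<Rightarrow> 'w \<Rightarrow> 'b::topological_space) \<Rightarrow> bool" where
  "adapted F Y \<longleftrightarrow> (\<forall>t\<ge>0. Y t \<in> borel_measurable (F t))"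

definition wiener_process ::
  "'w measure \<Rightarrow> (real \<Rightarrow> 'w measure) \<Rightarrow> (real \<Rightarrow> 'w \<Rightarrow> real^'d) \<Rightarrow> bool" where
  "wiener_process \<mu> F W \<longleftrightarrow>
     adapted F W \<and>
     (AE \<omega> in \<mu>. W 0 \<omega> = 0) \<and>
     (AE \<omega> in \<mu>. continuous_on {0..} (\<lambda>t. W t \<omega>)) \<and>
     (\<forall>s t. 0 \<le> s \<and> s < t \<longrightarrow>
        distributed \<mu> lborel (\<lambda>\<omega>. W t \<omega> - W s \<omega>)
          (\<lambda>x. ennreal (\<Prod>l\<in>UNIV. normal_density 0 (sqrt (t - s)) (x $ l))) \<and>
        prob_space.indep_set \<mu> (sets (F s))
          {(\<lambda>\<omega>. W t \<omega> - W s \<omega>) -` A \<inter> space \<mu> | A. A \<in> sets borel})"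

definition simple_integrand ::
  "(real \<Rightarrow> 'w measure) \<Rightarrow> real \<Rightarrow> nat \<Rightarrow> (nat \<Rightarrow> real) \<Rightarrow> (nat \<Rightarrow> 'w \<Rightarrow> real) \<Rightarrow> bool" where
  "simple_integrand F t k \<tau> \<xi> \<longleftrightarrow>
     \<tau> 0 = 0 \<and> \<tau> k = t \<and> mono_on {..k} \<tau> \<and>
     (\<forall>i<k. \<xi> i \<in> borel_measurable (F (\<tau> i)) \<and>
            (\<exists>C. \<forall>\<omega>\<in>space (F (\<tau> i)). \<bar>\<xi> i \<omega>\<bar> \<le> C))"

definition simple_process ::
  "nat \<Rightarrow> (nat \<Rightarrow> real) \<Rightarrow> (nat \<Rightarrow> 'w \<Rightarrow> real) \<Rightarrow> real \<Rightarrow> 'w \<Rightarrow> real" where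
  "simple_process k \<tau> \<xi> s \<omega> = (\<Sum>i<k. \<xi> i \<omega> * indicator {\<tau> i<..\<tau> (Suc i)} s)"

definition simple_integral ::
  "(real \<Rightarrow> 'w \<Rightarrow> real) \<Rightarrow> nat \<Rightarrow> (nat \<Rightarrow> real) \<Rightarrow> (nat \<Rightarrow> 'w \<Rightarrow> real) \<Rightarrow> 'w \<Rightarrow> real" where
  "simple_integral B k \<tau> \<xi> \<omega> = (\<Sum>i<k. \<xi> i \<omega> * (B (\<tau> (Suc i)) \<omega> - B (\<tau> i) \<omega>))"

text \<open>
  \<open>ito_integral \<mu> F B H t I\<close>: the integrand \<open>H\<close> is Ito integrable with respect to the
  one-dimensional Wiener process \<open>B\<close> on \<open>[0, t]\<close> and \<open>I\<close> is a version of \<open>\<integral>\<^sub>0\<^sup>t H dB\<close>.  Here \<open>H\<close> is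
  measurable and adapted, and approximated by simple integrands in the sense that
  \<open>\<integral>\<^sub>0\<^sup>t (H\<^sub>n - H)\<^sup>2 ds \<rightarrow> 0\<close> in probability; this forces \<open>\<integral>\<^sub>0\<^sup>t H\<^sup>2 ds < \<infinity>\<close> almost surely.
\<close>

definition ito_integral ::
  "'w measure \<Rightarrow> (real \<Rightarrow> 'w measure) \<Rightarrow> (real \<Rightarrow> 'w \<Rightarrow> real) \<Rightarrow> (real \<Rightarrow> 'w \<Rightarrow> real)
     \<Rightarrow> real \<Rightarrow> ('w \<Rightarrow> real) \<Rightarrow> bool" where
  "ito_integral \<mu> F B H t I \<longleftrightarrow>
     (\<lambda>(s, \<omega>). H s \<omega>) \<in> borel_measurable (restrict_space borel {0..t} \<Otimes>\<^sub>M \<mu>) \<and>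
     (\<forall>s\<in>{0..t}. H s \<in> borel_measurable (F s)) \<and>
     I \<in> borel_measurable \<mu> \<and>
     (\<exists>k \<tau> \<xi>.
        (\<forall>n. simple_integrand F t (k n) (\<tau> n) (\<xi> n)) \<and>
        (\<forall>\<epsilon>>0. (\<lambda>n. measure \<mu> {\<omega>\<in>space \<mu>. ennreal \<epsilon> <
             (\<integral>\<^sup>+ s\<in>{0..t}. ennreal ((simple_process (k n) (\<tau> n) (\<xi> n) s \<omega> - H s \<omega>)\<^sup>2) \<partial>lborel)})
           \<longlonglongrightarrow> 0) \<and>
        (\<forall>\<epsilon>>0. (\<lambda>n. measure \<mu> {\<omega>\<in>space \<mu>.
             \<epsilon> < \<bar>simple_integral B (k n) (\<tau> n) (\<xi> n) \<omega> - I \<omega>\<bar>}) \<longlonglongrightarrow> 0))"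

definition cadlag :: "'a topology \<Rightarrow> (real \<Rightarrow> 'a) \<Rightarrow> bool" where
  "cadlag X \<gamma> \<longleftrightarrow>
     (\<forall>t\<ge>0. limitin X \<gamma> (\<gamma> t) (at_right t)) \<and> (\<forall>t>0. \<exists>y. limitin X \<gamma> y (at_left t))"

definition martingale ::
  "'w measure \<Rightarrow> (real \<Rightarrow> 'w measure) \<Rightarrow> (real \<Rightarrow> 'w \<Rightarrow> real) \<Rightarrow> bool" where
  "martingale \<mu> F Y \<longleftrightarrow>
     adapted F Y \<and> (\<forall>t\<ge>0. integrable \<mu> (Y t)) \<and>
     (\<forall>s t. 0 \<le> s \<and> s \<le> t \<longrightarrow> (AE \<omega> in \<mu>. real_cond_exp \<mu> (F s) (Y t) \<omega> = Y s \<omega>))"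

definition local_martingale ::
  "'w measure \<Rightarrow> (real \<Rightarrow> 'w measure) \<Rightarrow> (real \<Rightarrow> 'w \<Rightarrow> real) \<Rightarrow> bool" where
  "local_martingale \<mu> F Y \<longleftrightarrow>
     adapted F Y \<and> (AE \<omega> in \<mu>. cadlag euclideanreal (\<lambda>t. Y t \<omega>)) \<and>
     (\<exists>T :: nat \<Rightarrow> 'w \<Rightarrow> real.
        (\<forall>n. stopping_time F (T n) \<and> (\<forall>\<omega>\<in>space \<mu>. 0 \<le> T n \<omega>)) \<and>
        (AE \<omega> in \<mu>. incseq (\<lambda>n. T n \<omega>) \<and> filterlim (\<lambda>n. T n \<omega>) at_top sequentially) \<and>
        (\<forall>n. martingale \<mu> F (\<lambda>t \<omega>. Y (min t (T n \<omega>)) \<omega> - Y 0 \<omega>)))"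

definition locally_finite_variation :: "(real \<Rightarrow> real) \<Rightarrow> bool" where
  "locally_finite_variation a \<longleftrightarrow>
     (\<forall>t\<ge>0. \<exists>C. \<forall>k. \<forall>\<tau>::nat \<Rightarrow> real. mono_on {..k} \<tau> \<and> 0 \<le> \<tau> 0 \<and> \<tau> k \<le> t \<longrightarrow>
        (\<Sum>i<k. \<bar>a (\<tau> (Suc i)) - a (\<tau> i)\<bar>) \<le> C)"

definition real_semimartingale ::
  "'w measure \<Rightarrow> (real \<Rightarrow> 'w measure) \<Rightarrow> (real \<Rightarrow> 'w \<Rightarrow> real) \<Rightarrow> bool" where
  "real_semimartingale \<mu> F Y \<longleftrightarrow>
     adapted F Y \<and>
     (\<exists>L A. local_martingale \<mu> F L \<and> adapted F A \<and>
        (AE \<omega> in \<mu>. cadlag euclideanreal (\<lambda>t. A t \<omega>) \<and>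
           locally_finite_variation (\<lambda>t. A t \<omega>)) \<and>
        (AE \<omega> in \<mu>. L 0 \<omega> = 0 \<and> A 0 \<omega> = 0) \<and>
        (AE \<omega> in \<mu>. \<forall>t\<ge>0. Y t \<omega> = Y 0 \<omega> + L t \<omega> + A t \<omega>))"

text \<open>
  A manifold valued semimartingale is a process whose image under every smooth function is a real
  semimartingale.  Paths may jump; continuous semimartingales are included.
\<close>

definition mfd_semimartingale ::
  "'w measure \<Rightarrow> (real \<Rightarrow> 'w measure) \<Rightarrow> 'a mfd \<Rightarrow> (real \<Rightarrow> 'w \<Rightarrow> 'a) \<Rightarrow> bool" where
  "mfd_semimartingale \<mu> F M Z \<longleftrightarrow>
     (\<forall>t\<ge>0. \<forall>\<omega>\<in>space \<mu>. Z t \<omega> \<in> points M) \<and>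
     (AE \<omega> in \<mu>. cadlag (mtop M) (\<lambda>t. Z t \<omega>)) \<and>
     (\<forall>f\<in>smooth_funs M. real_semimartingale \<mu> F (\<lambda>t \<omega>. f (Z t \<omega>)))"

definition drift_op ::
  "('m \<Rightarrow> 'n \<Rightarrow> 'm pt_op) \<Rightarrow> ('m \<Rightarrow> 'm pt_op \<Rightarrow> 'm pt_op) \<Rightarrow> ('d::finite \<Rightarrow> 'm \<Rightarrow> 'm pt_op)
     \<Rightarrow> 'm \<Rightarrow> 'n \<Rightarrow> 'm pt_op" where
  "drift_op V G \<sigma> x u = (\<lambda>f. V x u f + 1 / 2 * (\<Sum>l\<in>UNIV. G x (\<sigma> l x) f))"

definition solves_sde ::
  "'w measure \<Rightarrow> (real \<Rightarrow> 'w measure) \<Rightarrow> (real \<Rightarrow> 'w \<Rightarrow> real^'d) \<Rightarrow> 'm mfd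
     \<Rightarrow> ('m \<Rightarrow> 'n \<Rightarrow> 'm pt_op) \<Rightarrow> ('m \<Rightarrow> 'm pt_op \<Rightarrow> 'm pt_op) \<Rightarrow> ('d \<Rightarrow> 'm \<Rightarrow> 'm pt_op)
     \<Rightarrow> (real \<Rightarrow> 'w \<Rightarrow> 'm) \<Rightarrow> (real \<Rightarrow> 'w \<Rightarrow> 'n) \<Rightarrow> bool" where
  "solves_sde \<mu> F W M V G \<sigma> X U \<longleftrightarrow>
     (\<forall>f\<in>smooth_funs M. \<forall>t\<ge>0.
        (AE \<omega> in \<mu>. set_integrable lborel {0..t} (\<lambda>s. drift_op V G \<sigma> (X s \<omega>) (U s \<omega>) f)) \<and>
        (\<exists>I. (\<forall>l. ito_integral \<mu> F (\<lambda>s \<omega>. W s \<omega> $ l) (\<lambda>s \<omega>. \<sigma> l (X s \<omega>) f) t (I l)) \<and>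
           (AE \<omega> in \<mu>. f (X t \<omega>) = f (X 0 \<omega>) +
              (LINT s:{0..t}|lborel. drift_op V G \<sigma> (X s \<omega>) (U s \<omega>) f) +
              (\<Sum>l\<in>UNIV. I l \<omega>))))"

text \<open>
  The system has completely high index: \<open>h\<close> is a function on \<open>M\<close> alone.
\<close>

definition sdae_solution ::
  "'w measure \<Rightarrow> (real \<Rightarrow> 'w measure) \<Rightarrow> (real \<Rightarrow> 'w \<Rightarrow> real^'d) \<Rightarrow> 'm mfd \<Rightarrow> 'n mfd
     \<Rightarrow> ('m \<Rightarrow> 'n \<Rightarrow> 'm pt_op) \<Rightarrow> ('m \<Rightarrow> 'm pt_op \<Rightarrow> 'm pt_op) \<Rightarrow> ('d \<Rightarrow> 'm \<Rightarrow> 'm pt_op)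
     \<Rightarrow> ('m \<Rightarrow> 'p) \<Rightarrow> 'p \<Rightarrow> (real \<Rightarrow> 'w \<Rightarrow> 'm) \<Rightarrow> (real \<Rightarrow> 'w \<Rightarrow> 'n) \<Rightarrow> bool" where
  "sdae_solution \<mu> F W M N V G \<sigma> h p X U \<longleftrightarrow>
     mfd_semimartingale \<mu> F (prod_mfd M N) (\<lambda>t \<omega>. (X t \<omega>, U t \<omega>)) \<and>
     solves_sde \<mu> F W M V G \<sigma> X U \<and>
     (\<forall>t\<ge>0. AE \<omega> in \<mu>. h (X t \<omega>) = p)"

text \<open>
  That the \<open>\<sigma> l\<close> do not depend on the algebraic variable is part of their being vector fields
  on \<open>M\<close>.
\<close>

definition ill_posed ::
  "'m mfd \<Rightarrow> 'p mfd \<Rightarrow> ('m \<Rightarrow> 'p) \<Rightarrow> ('d \<Rightarrow> 'm \<Rightarrow> 'm pt_op) \<Rightarrow> bool" where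
  "ill_posed M P h \<sigma> \<longleftrightarrow>
     (\<forall>l. \<sigma> l \<in> vector_fields M) \<and>
     (\<forall>x\<in>points M. \<exists>l. \<sigma> l x \<notin> tangent_ker M P h x)"

end

theory Submission
  imports Defs
begin

text \<open>
  Let \<open>f = g \<circ> h - g(p)\<close>, which vanishes along any solution.  The equation for \<open>f\<^sup>2\<close> has diffusion
  coefficients \<open>2 f \<sigma>\<^sub>l[f]\<close>, which are zero along the solution, and by the condition on the symmetric
  part of the generator its drift there is \<open>\<Sum>\<^sub>l (\<sigma>\<^sub>l[f])\<^sup>2\<close>.  As an Ito integral of zero is zero, the
  time integral of this sum of squares vanishes, so \<open>\<sigma>\<^sub>l[f] = 0\<close> at almost every time.  By
  ill-posedness and second countability, countably many open sets \<open>{\<sigma>\<^sub>l[f] \<noteq> 0}\<close> cover \<open>M\<close>, so this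
  fails somewhere.
\<close>

subsection \<open>Smooth functions and tangent vectors\<close>

text \<open>The equation for \<open>f\<close> itself only says that a time integral and a sum of Ito
  integrals cancel, and telling the two apart would take quadratic variation. For
  \<open>f\<^sup>2\<close> the stochastic integrands are zero along the path, while the diffusion
  reappears in the drift as squares, which cannot cancel. The probabilistic core is that any
  \<open>I\<close> related by \<open>ito_integral\<close> to a vanishing integrand is zero almost
  surely. The approximating simple integrands have small energy only in probability, so the isometry
  cannot be applied to them directly; they are first cut off at a small energy. The remaining
  obstacle is null sets. The constraint and the equation hold outside null sets that depend on the
  time and on the test function, whereas the contradiction needs one path and one time. Rational
  times with right-continuous paths remove the first dependence of the constraint, a countable
  subcover the dependence on the function.\<close>

lemma open_Euclidean_space_line:
  assumes "openin (Euclidean_space n) S" "x \<in> S" "i < n"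
  shows "\<forall>\<^sub>F s in nhds (x i). x(i := s) \<in> S"
proof -
  have x: "\<forall>j\<ge>n. x j = 0"
    using assms openin_subset topspace_Euclidean_space by fastforce
  have "continuous_map euclideanreal (Euclidean_space n) (\<lambda>s. x(i := s))"
    unfolding Euclidean_space_def continuous_map_in_subtopology continuous_map_componentwise_UNIV
    using x assms(3) by (auto simp: fun_upd_def)
  then have "open {s. x(i := s) \<in> S}"
    using openin_continuous_map_preimage[OF _ assms(1), of euclideanreal "\<lambda>s. x(i := s)"] by simp
  then show ?thesis
    using eventually_nhds_in_open[of "{s. x(i := s) \<in> S}" "x i"] assms(2) by simp
qed

text \<open>A derivative depends only on values near the point, and openness of \<open>S\<close>
  keeps a short segment of each coordinate line through \<open>x\<close> inside
  \<open>S\<close>.\<close>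

lemma partial_deriv_cong:
  assumes "openin (Euclidean_space n) S" "x \<in> S" "i < n" "\<And>y. y \<in> S \<Longrightarrow> f y = g y"
  shows "partial_deriv i f x = partial_deriv i g x"
  unfolding partial_deriv_def
  by (rule deriv_cong_ev[OF _ refl])
    (rule eventually_mono[OF open_Euclidean_space_line[OF assms(1-3)]], simp add: assms(4))

text \<open>Sum and product rules determine partial derivatives only on \<open>S\<close>, but
  \<open>partial_deriv\<close> is a total function. Smoothness must survive changes off
  \<open>S\<close> before these rules can be used inside the recursion of
  \<open>Ck_on\<close>.\<close>

lemma Ck_on_cong:
  assumes S: "openin (Euclidean_space n) S"
    and "\<And>y. y \<in> S \<Longrightarrow> f y = g y" and "Ck_on n k S f"
  shows "Ck_on n k S g"
  using assms(2,3)
proof (induction k arbitrary: f g)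
  case 0
  then show ?case
    using continuous_map_eq[of "subtopology (Euclidean_space n) S" euclideanreal f g] by simp
next
  case (Suc k)
  have "(\<lambda>s. g (x(i := s))) differentiable at (x i)" if "i < n" "x \<in> S" for i x
  proof -
    have "\<forall>\<^sub>F s in nhds (x i). f (x(i := s)) = g (x(i := s))"
      by (rule eventually_mono[OF open_Euclidean_space_line[OF S that(2,1)]]) (rule Suc.prems(1))
    note DERIV_cong_ev[OF refl this refl]
    moreover have "(\<lambda>s. f (x(i := s))) differentiable at (x i)"
      using Suc.prems that by simp
    ultimately show ?thesis
      unfolding real_differentiable_def by blast
  qed
  moreover have "Ck_on n k S (partial_deriv i g)" if "i < n" for i
    by (rule Suc.IH[of "partial_deriv i f"])
      (use Suc.prems that in \<open>auto intro: partial_deriv_cong[OF S]\<close>)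
  moreover have "continuous_map (subtopology (Euclidean_space n) S) euclideanreal g"
    using Suc.prems continuous_map_eq[of "subtopology (Euclidean_space n) S" euclideanreal f g]
    by simp
  ultimately show ?case by simp
qed

lemma Ck_on_Suc: "Ck_on n (Suc k) S f \<Longrightarrow> Ck_on n k S f"
proof (induction k arbitrary: f)
  case (Suc k)
  then show ?case
    unfolding Ck_on.simps(2)[of n k] Ck_on.simps(2)[of n "Suc k"] by blast
qed (simp only: Ck_on.simps)

lemma Ck_on_partial_deriv:
  assumes "Ck_on n (Suc k) S f" "x \<in> S" "i < n"
  shows "((\<lambda>s. f (x(i := s))) has_real_derivative partial_deriv i f x) (at (x i))"
  using assms unfolding partial_deriv_def by (simp add: DERIV_deriv_iff_real_differentiable)

lemma partial_deriv_add:
  assumes "Ck_on n (Suc k) S f" "Ck_on n (Suc k) S g" "x \<in> S" "i < n"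
  shows "((\<lambda>s. f (x(i := s)) + g (x(i := s))) has_real_derivative
      partial_deriv i f x + partial_deriv i g x) (at (x i))"
    and "partial_deriv i (\<lambda>y. f y + g y) x = partial_deriv i f x + partial_deriv i g x"
proof -
  show D: "((\<lambda>s. f (x(i := s)) + g (x(i := s))) has_real_derivative
      partial_deriv i f x + partial_deriv i g x) (at (x i))"
    using assms by (intro DERIV_add Ck_on_partial_deriv)
  then show "partial_deriv i (\<lambda>y. f y + g y) x = partial_deriv i f x + partial_deriv i g x"
    unfolding partial_deriv_def[of i "\<lambda>y. f y + g y"] by (rule DERIV_imp_deriv)
qed

lemma partial_deriv_mult:
  assumes "Ck_on n (Suc k) S f" "Ck_on n (Suc k) S g" "x \<in> S" "i < n"
  shows "((\<lambda>s. f (x(i := s)) * g (x(i := s))) has_real_derivative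
      partial_deriv i f x * g x + f x * partial_deriv i g x) (at (x i))"
    and "partial_deriv i (\<lambda>y. f y * g y) x = partial_deriv i f x * g x + f x * partial_deriv i g x"
proof -
  show D: "((\<lambda>s. f (x(i := s)) * g (x(i := s))) has_real_derivative
      partial_deriv i f x * g x + f x * partial_deriv i g x) (at (x i))"
    using DERIV_mult[OF Ck_on_partial_deriv[OF assms(1,3,4)] Ck_on_partial_deriv[OF assms(2,3,4)]]
    by (simp add: ac_simps)
  then show "partial_deriv i (\<lambda>y. f y * g y) x =
      partial_deriv i f x * g x + f x * partial_deriv i g x"
    unfolding partial_deriv_def[of i "\<lambda>y. f y * g y"] by (rule DERIV_imp_deriv)
qed

lemma Ck_on_const: "Ck_on n k S (\<lambda>x. c)"
proof (induction k arbitrary: c)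
  case (Suc k)
  have "partial_deriv i (\<lambda>x. c) = (\<lambda>x. 0)" for i
    by (simp add: partial_deriv_def fun_eq_iff)
  with Suc show ?case by simp
qed simp

lemma Ck_on_add:
  assumes S: "openin (Euclidean_space n) S" and "Ck_on n k S f" "Ck_on n k S g"
  shows "Ck_on n k S (\<lambda>x. f x + g x)"
  using assms(2,3)
proof (induction k arbitrary: f g)
  case (Suc k)
  have "Ck_on n k S (partial_deriv i (\<lambda>x. f x + g x))" if "i < n" for i
    by (rule Ck_on_cong[OF S _ Suc.IH[of "partial_deriv i f" "partial_deriv i g"]])
      (use Suc.prems that in \<open>auto simp: partial_deriv_add(2)[OF Suc.prems]\<close>)
  moreover have "(\<lambda>s. f (x(i := s)) + g (x(i := s))) differentiable at (x i)"
    if "i < n" "x \<in> S" for i x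
    using partial_deriv_add(1)[OF Suc.prems that(2,1)] unfolding real_differentiable_def by blast
  ultimately show ?case
    using Suc.prems by (auto intro: continuous_map_add)
qed (auto intro: continuous_map_add)

lemma Ck_on_mult:
  assumes S: "openin (Euclidean_space n) S" and "Ck_on n k S f" "Ck_on n k S g"
  shows "Ck_on n k S (\<lambda>x. f x * g x)"
  using assms(2,3)
proof (induction k arbitrary: f g)
  case (Suc k)
  \<comment> \<open>In each product of the Leibniz rule one factor has lost a derivative; the other
    is lowered to order \<open>k\<close> by \<open>Ck_on_Suc\<close>, so that the induction
    hypothesis covers both products.\<close>
  have "Ck_on n k S (partial_deriv i (\<lambda>x. f x * g x))" if "i < n" for i
    by (rule Ck_on_cong[OF S _ Ck_on_add[OF S
          Suc.IH[of "partial_deriv i f" g] Suc.IH[of f "partial_deriv i g"]]])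
      (use Suc.prems Ck_on_Suc[OF Suc.prems(1)] Ck_on_Suc[OF Suc.prems(2)] that in
        \<open>auto simp: partial_deriv_mult(2)[OF Suc.prems]\<close>)
  moreover have "(\<lambda>s. f (x(i := s)) * g (x(i := s))) differentiable at (x i)"
    if "i < n" "x \<in> S" for i x
    using partial_deriv_mult(1)[OF Suc.prems that(2,1)] unfolding real_differentiable_def by blast
  ultimately show ?case
    using Suc.prems by (auto intro: continuous_map_real_mult)
qed (auto intro: continuous_map_real_mult)

section \<open>Smooth functions on a manifold\<close>

lemma chartD:
  assumes "smooth_manifold M" "(U, \<phi>) \<in> charts M"
  shows "openin (mtop M) U" "openin (Euclidean_space (mdim M)) (\<phi> ` U)" "inj_on \<phi> U"
    "continuous_map (subtopology (mtop M) U) (subtopology (Euclidean_space (mdim M)) (\<phi> ` U)) \<phi>"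
proof -
  have c: "is_chart M U \<phi>"
    using assms by (auto simp: smooth_manifold_def)
  then show "openin (mtop M) U" "openin (Euclidean_space (mdim M)) (\<phi> ` U)"
    by (auto simp: is_chart_def)
  show "continuous_map (subtopology (mtop M) U) (subtopology (Euclidean_space (mdim M)) (\<phi> ` U)) \<phi>"
    using c by (auto simp: is_chart_def homeomorphic_imp_continuous_map)
  show "inj_on \<phi> U"
    using c homeomorphic_imp_injective_map[of "subtopology (mtop M) U" _ \<phi>] openin_subset[of "mtop M" U]
    by (auto simp: is_chart_def Int_absorb1)
qed

lemma smooth_funs_Ck_on:
  assumes "f \<in> smooth_funs M" "(U, \<phi>) \<in> charts M"
  shows "Ck_on (mdim M) k (\<phi> ` U) (\<lambda>y. f (inv_into U \<phi> y))"
  using assms unfolding smooth_funs_def smooth_on_def by blast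

lemma smooth_funsI:
  assumes "\<And>U \<phi> k. (U, \<phi>) \<in> charts M \<Longrightarrow> Ck_on (mdim M) k (\<phi> ` U) (\<lambda>y. f (inv_into U \<phi> y))"
  shows "f \<in> smooth_funs M"
  using assms unfolding smooth_funs_def smooth_on_def by blast

lemma smooth_funs_const: "(\<lambda>x. c) \<in> smooth_funs M"
  by (rule smooth_funsI) (rule Ck_on_const)

lemma smooth_funs_add:
  assumes "smooth_manifold M" "f \<in> smooth_funs M" "g \<in> smooth_funs M"
  shows "(\<lambda>x. f x + g x) \<in> smooth_funs M"
  by (rule smooth_funsI, rule Ck_on_add)
    (erule chartD(2)[OF assms(1)], erule smooth_funs_Ck_on[OF assms(2)],
      erule smooth_funs_Ck_on[OF assms(3)])

lemma smooth_funs_mult: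
  assumes "smooth_manifold M" "f \<in> smooth_funs M" "g \<in> smooth_funs M"
  shows "(\<lambda>x. f x * g x) \<in> smooth_funs M"
  by (rule smooth_funsI, rule Ck_on_mult)
    (erule chartD(2)[OF assms(1)], erule smooth_funs_Ck_on[OF assms(2)],
      erule smooth_funs_Ck_on[OF assms(3)])

text \<open>On each chart domain \<open>f\<close> is its continuous coordinate expression composed
  with the chart, and these open domains cover \<open>M\<close>. Continuity later makes the sets of
  nonzero coefficients open and lets \<open>f\<close> follow right limits of paths.\<close>

lemma smooth_funs_continuous:
  assumes M: "smooth_manifold M" and f: "f \<in> smooth_funs M"
  shows "continuous_map (mtop M) euclideanreal f"
proof (rule pasting_lemma[where I = "charts M" and T = fst and f = "\<lambda>_. f"])
  fix c assume c: "c \<in> charts M"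
  obtain U \<phi> where [simp]: "c = (U, \<phi>)" by (cases c)
  note * = chartD[OF M, of U \<phi>]
  have "Ck_on (mdim M) 0 (\<phi> ` U) (\<lambda>y. f (inv_into U \<phi> y))"
    using f c by (intro smooth_funs_Ck_on) simp_all
  then have "continuous_map (subtopology (mtop M) U) euclideanreal ((\<lambda>y. f (inv_into U \<phi> y)) \<circ> \<phi>)"
    using * c by (auto intro: continuous_map_compose)
  then have "continuous_map (subtopology (mtop M) U) euclideanreal f"
    by (rule continuous_map_eq) (use * c in auto)
  then show "continuous_map (subtopology (mtop M) (fst c)) euclideanreal f" by simp
  show "openin (mtop M) (fst c)" using * c by simp
next
  fix x assume "x \<in> points M"
  moreover have "(\<Union>(U, \<phi>) \<in> charts M. U) = points M"
    using M by (simp add: smooth_manifold_def)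
  ultimately show "\<exists>c. c \<in> charts M \<and> x \<in> fst c \<and> f x = f x"
    by fastforce
qed auto

section \<open>Tangent vectors and generators acting on squares\<close>

lemma tangent_spaceD:
  assumes "v \<in> tangent_space M x" "f \<in> smooth_funs M" "g \<in> smooth_funs M"
  shows "v (\<lambda>y. f y + g y) = v f + v g" "v (\<lambda>y. c * f y) = c * v f"
    "v (\<lambda>y. f y * g y) = f x * v g + g x * v f"
  using assms by (simp_all add: tangent_space_def)

text \<open>The Leibniz rule on \<open>1 * 1\<close> gives \<open>v 1 = 2 * v 1\<close>, so
  \<open>v 1 = 0\<close>; homogeneity does the rest.\<close>

lemma tangent_const:
  assumes "v \<in> tangent_space M x"
  shows "v (\<lambda>y. c) = 0"
  using tangent_spaceD(2)[OF assms smooth_funs_const[of 1] smooth_funs_const, of c]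
    tangent_spaceD(3)[OF assms smooth_funs_const[of 1] smooth_funs_const[of 1]] by simp

text \<open>Allows \<open>g \<circ> h\<close> to be normalised to vanish on the fibre over
  \<open>p\<close> without changing its derivatives.\<close>

lemma tangent_shift:
  assumes "v \<in> tangent_space M x" "f \<in> smooth_funs M"
  shows "v (\<lambda>y. f y + c) = v f"
  using tangent_spaceD(1)[OF assms smooth_funs_const[of c]] tangent_const[OF assms(1)] by simp

lemma tangent_square_zero:
  assumes "v \<in> tangent_space M x" "f \<in> smooth_funs M" "f x = 0"
  shows "v (\<lambda>y. f y * f y) = 0"
  using tangent_spaceD(3)[OF assms(1,2,2)] assms(3) by simp

text \<open>
  On the square of a function vanishing at \<open>x\<close> the first order part of the generator drops out;
  this takes the place of Ito's formula.
\<close>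

lemma generator_square_zero:
  assumes M: "smooth_manifold M" and G: "diffusion_generator M G"
    and x: "x \<in> points M" and Y: "Y \<in> tangent_space M x"
    and f: "f \<in> smooth_funs M" and fx: "f x = 0"
  shows "G x Y (\<lambda>y. f y * f y) = 2 * (Y f)\<^sup>2"
proof -
  have "has_symmetric_part M x (G x Y) (vec_tensor Y Y)"
    using G x Y by (simp add: diffusion_generator_def)
  \<comment> \<open>The local form is the one contained in \<open>has_symmetric_part\<close>, so the
    same chart and the same \<open>b\<close> describe both \<open>G x Y\<close> and the tensor
    square of \<open>Y\<close>.\<close>
  then obtain U \<phi> a b where L: "local_form M x U \<phi> a b (G x Y)"
    and T: "vec_tensor Y Y = (\<lambda>f g. if f \<in> smooth_funs M \<and> g \<in> smooth_funs M then
       (\<Sum>i < mdim M. \<Sum>j < mdim M. b i j *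
          (partial_deriv i (\<lambda>y. f (inv_into U \<phi> y)) (\<phi> x) *
           partial_deriv j (\<lambda>y. g (inv_into U \<phi> y)) (\<phi> x))) else 0)"
    unfolding has_symmetric_part_def by blast
  define g where "g = (\<lambda>y. f (inv_into U \<phi> y))"
  define S where "S = \<phi> ` U"
  have ch: "(U, \<phi>) \<in> charts M" "x \<in> U"
    using L by (auto simp: local_form_def)
  note * = chartD[OF M ch(1)]
  have S: "openin (Euclidean_space (mdim M)) S" "\<phi> x \<in> S"
    using * ch by (auto simp: S_def)
  have gx: "g (\<phi> x) = 0"
    using * ch fx by (simp add: g_def)
  have Ck: "Ck_on (mdim M) k S g" for k
    unfolding g_def S_def using f ch by (intro smooth_funs_Ck_on)
  have d: "partial_deriv i (\<lambda>y. g y * g y) y = 2 * g y * partial_deriv i g y"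
    if "i < mdim M" "y \<in> S" for i y
    by (subst partial_deriv_mult(2)[OF Ck[of "Suc 0"] Ck that(2,1)]) auto
  \<comment> \<open>The other term of the product rule, \<open>2 * g\<close> times a second
    derivative of \<open>g\<close>, is zero because \<open>g\<close> vanishes at
    \<open>\<phi> x\<close>.\<close>
  have dd: "partial_deriv i (partial_deriv j (\<lambda>y. g y * g y)) (\<phi> x)
      = 2 * (partial_deriv i g (\<phi> x) * partial_deriv j g (\<phi> x))"
    if "i < mdim M" "j < mdim M" for i j
  proof -
    have C1: "Ck_on (mdim M) (Suc 0) S (\<lambda>y. 2 * g y)"
      by (rule Ck_on_mult[OF S(1) Ck_on_const Ck])
    have C2: "Ck_on (mdim M) (Suc 0) S (partial_deriv j g)"
      using Ck[of "Suc (Suc 0)"] that by auto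
    have "partial_deriv i (\<lambda>y. 2 * g y) (\<phi> x) = 2 * partial_deriv i g (\<phi> x)"
      using partial_deriv_mult(2)[OF Ck_on_const[of _ "Suc 0" _ 2] Ck S(2) that(1)]
      by (simp add: partial_deriv_def)
    moreover have "partial_deriv i (partial_deriv j (\<lambda>y. g y * g y)) (\<phi> x)
        = partial_deriv i (\<lambda>y. 2 * g y * partial_deriv j g y) (\<phi> x)"
      by (rule partial_deriv_cong[OF S that(1)]) (simp add: d that)
    ultimately show ?thesis
      using partial_deriv_mult(2)[of _ 0 S "\<lambda>y. 2 * g y" "partial_deriv j g" "\<phi> x" i] C1 C2 S that gx
      by simp
  qed
  have "G x Y (\<lambda>y. f y * f y) =
        (\<Sum>i < mdim M. a i * partial_deriv i (\<lambda>y. g y * g y) (\<phi> x)) +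
        (\<Sum>i < mdim M. \<Sum>j < mdim M.
           b i j * partial_deriv i (partial_deriv j (\<lambda>y. g y * g y)) (\<phi> x))"
    using L smooth_funs_mult[OF M f f] by (auto simp: local_form_def g_def)
  also have "\<dots> = 2 * (\<Sum>i < mdim M. \<Sum>j < mdim M. b i j *
      (partial_deriv i g (\<phi> x) * partial_deriv j g (\<phi> x)))"
    using S by (simp add: d dd gx sum_distrib_left ac_simps)
  also have "\<dots> = 2 * vec_tensor Y Y f f"
    using f by (simp add: T g_def)
  finally show ?thesis by (simp add: vec_tensor_def power2_eq_square)
qed

subsection \<open>The Ito integral of a vanishing integrand\<close>

text \<open>What the isometry uses of a scalar Wiener process. Independence is phrased for random
  variables known at time \<open>s\<close>, the form in which expectations of products
  factor.\<close>

locale real_wiener = prob_space M for M :: "'w measure" +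
  fixes F :: "real \<Rightarrow> 'w measure" and B :: "real \<Rightarrow> 'w \<Rightarrow> real"
  assumes filtration: "filtration (space M) F"
    and subalgebra: "\<And>t. subalgebra M (F t)"
    and adapted: "\<And>t. 0 \<le> t \<Longrightarrow> B t \<in> borel_measurable (F t)"
    and increment: "\<And>s t. 0 \<le> s \<Longrightarrow> s < t \<Longrightarrow>
      distributed M lborel (\<lambda>\<omega>. B t \<omega> - B s \<omega>) (normal_density 0 (sqrt (t - s)))"
    and indep: "\<And>s t Z. 0 \<le> s \<Longrightarrow> s < t \<Longrightarrow> Z \<in> borel_measurable (F s) \<Longrightarrow>
      indep_var borel Z borel (\<lambda>\<omega>. B t \<omega> - B s \<omega>)"
begin

lemma measurable_F_mono: "s \<le> t \<Longrightarrow> f \<in> borel_measurable (F s) \<Longrightarrow> f \<in> borel_measurable (F t)"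
  using filtration measurable_from_subalg[of "F t" "F s" f borel]
  by (auto simp: filtration_def subalgebra_def)

lemma measurable_F: "f \<in> borel_measurable (F t) \<Longrightarrow> f \<in> borel_measurable M"
  using measurable_from_subalg subalgebra by blast

text \<open>By independence the expectations factor, and the increment has mean 0 and variance
  \<open>t - s\<close>. For the same reason integrability of \<open>Z\<close> alone suffices for the
  products.\<close>

lemma increment_mult:
  assumes st: "0 \<le> s" "s \<le> t" and Z: "Z \<in> borel_measurable (F s)" "integrable M Z"
  shows "integrable M (\<lambda>\<omega>. Z \<omega> * (B t \<omega> - B s \<omega>))"
    and "(\<integral>\<omega>. Z \<omega> * (B t \<omega> - B s \<omega>) \<partial>M) = 0"
    and "integrable M (\<lambda>\<omega>. Z \<omega> * (B t \<omega> - B s \<omega>)\<^sup>2)"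
    and "(\<integral>\<omega>. Z \<omega> * (B t \<omega> - B s \<omega>)\<^sup>2 \<partial>M) = (t - s) * (\<integral>\<omega>. Z \<omega> \<partial>M)"
proof -
  let ?D = "\<lambda>\<omega>. B t \<omega> - B s \<omega>"
  have "integrable M (\<lambda>\<omega>. Z \<omega> * ?D \<omega>) \<and> (\<integral>\<omega>. Z \<omega> * ?D \<omega> \<partial>M) = 0 \<and>
    integrable M (\<lambda>\<omega>. Z \<omega> * (?D \<omega>)\<^sup>2) \<and> (\<integral>\<omega>. Z \<omega> * (?D \<omega>)\<^sup>2 \<partial>M) = (t - s) * (\<integral>\<omega>. Z \<omega> \<partial>M)"
  \<comment> \<open>A zero-length increment has no normal density; there every claim is
    trivial.\<close>
  proof (cases "s = t")
    case False
    then have lt: "s < t" "0 < sqrt (t - s)" using st by auto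
    note D = increment[OF st(1) lt(1)]
    have i1: "integrable M ?D"
      using distributed_integrable[OF D, of "\<lambda>x. x"] integrable_normal_moment_nz_1[OF lt(2), of 0]
      by simp
    have i2: "integrable M (\<lambda>\<omega>. (?D \<omega>)\<^sup>2)"
      using distributed_integrable[OF D, of "\<lambda>x. x\<^sup>2"] integrable_normal_moment[OF lt(2), of 0 2]
      by simp
    have e1: "expectation ?D = 0"
      by (rule normal_distributed_expectation[OF lt(2) D])
    have e2: "expectation (\<lambda>\<omega>. (?D \<omega>)\<^sup>2) = t - s"
      using normal_distributed_variance[OF lt(2) D] e1 lt by simp
    note ind = indep[OF st(1) lt(1) Z(1)]
    have ind2: "indep_var borel Z borel (\<lambda>\<omega>. (?D \<omega>)\<^sup>2)"
      using indep_var_compose[OF ind, of "\<lambda>x. x" borel "\<lambda>x. x\<^sup>2" borel] by (simp add: o_def)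
    show ?thesis
      using indep_var_integrable[OF ind Z(2) i1] indep_var_lebesgue_integral[OF ind Z(2) i1]
        indep_var_integrable[OF ind2 Z(2) i2] indep_var_lebesgue_integral[OF ind2 Z(2) i2] e1 e2
      by simp
  qed simp
  then show "integrable M (\<lambda>\<omega>. Z \<omega> * ?D \<omega>)" "(\<integral>\<omega>. Z \<omega> * ?D \<omega> \<partial>M) = 0"
    "integrable M (\<lambda>\<omega>. Z \<omega> * (?D \<omega>)\<^sup>2)"
    "(\<integral>\<omega>. Z \<omega> * (?D \<omega>)\<^sup>2 \<partial>M) = (t - s) * (\<integral>\<omega>. Z \<omega> \<partial>M)"
    by auto
qed

lemma simple_integral_measurable:
  assumes "mono_on {..k} \<tau>" "0 \<le> \<tau> 0" "\<And>i. i < k \<Longrightarrow> Z i \<in> borel_measurable (F (\<tau> i))" "m \<le> k"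
  shows "simple_integral B m \<tau> Z \<in> borel_measurable (F (\<tau> m))"
proof -
  have \<tau>: "\<tau> i \<le> \<tau> j" if "i \<le> j" "j \<le> m" for i j
    using assms(1,4) that by (auto simp: mono_on_def)
  have \<tau>0: "0 \<le> \<tau> i" if "i \<le> m" for i
    using \<tau>[of 0 i] that assms(2) by simp
  have "(\<lambda>\<omega>. Z i \<omega> * (B (\<tau> (Suc i)) \<omega> - B (\<tau> i) \<omega>)) \<in> borel_measurable (F (\<tau> m))" if "i < m" for i
    using that assms(4)
    by (intro borel_measurable_times borel_measurable_diff measurable_F_mono[OF \<tau> assms(3)]
        measurable_F_mono[OF \<tau> adapted] \<tau>0) auto
  then show ?thesis
    unfolding simple_integral_def[abs_def] by (intro borel_measurable_sum) auto
qed

text \<open>The Ito isometry, by induction on the number \<open>m\<close> of intervals inside a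
  fixed partition: the newest increment is independent of everything known at its left end, so the
  cross term has mean zero.\<close>

lemma simple_integral_second_moment:
  assumes \<tau>: "mono_on {..k} \<tau>" "0 \<le> \<tau> 0"
    and Z: "\<And>i. i < k \<Longrightarrow> Z i \<in> borel_measurable (F (\<tau> i))"
    and bnd: "\<And>i. i < k \<Longrightarrow> \<exists>C. \<forall>\<omega>\<in>space M. \<bar>Z i \<omega>\<bar> \<le> C"
    and "m \<le> k"
  shows "integrable M (\<lambda>\<omega>. (simple_integral B m \<tau> Z \<omega>)\<^sup>2) \<and>
    expectation (\<lambda>\<omega>. (simple_integral B m \<tau> Z \<omega>)\<^sup>2) =
      expectation (\<lambda>\<omega>. \<Sum>i<m. (Z i \<omega>)\<^sup>2 * (\<tau> (Suc i) - \<tau> i))"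
  using \<open>m \<le> k\<close>
proof (induction m)
  case 0
  then show ?case by (simp add: simple_integral_def)
next
  case (Suc m)
  then have m: "m < k" by simp
  let ?S = "simple_integral B m \<tau> Z" and ?D = "\<lambda>\<omega>. B (\<tau> (Suc m)) \<omega> - B (\<tau> m) \<omega>"
  have t: "0 \<le> \<tau> m" "\<tau> m \<le> \<tau> (Suc m)"
    using \<tau> mono_onD[OF \<tau>(1), of 0 m] mono_onD[OF \<tau>(1), of m "Suc m"] m by auto
  have bsq: "integrable M (\<lambda>\<omega>. (Z i \<omega>)\<^sup>2)" if i: "i < k" for i
  proof -
    obtain C where C: "\<forall>\<omega>\<in>space M. \<bar>Z i \<omega>\<bar> \<le> C" using bnd[OF i] by blast
    show ?thesis
      using measurable_F[OF Z[OF i]] C power_mono[of "\<bar>Z i _\<bar>" C 2]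
      by (intro integrable_const_bound[of _ "C\<^sup>2"]) auto
  qed
  have S[measurable]: "?S \<in> borel_measurable (F (\<tau> m))"
    using simple_integral_measurable[OF \<tau> Z] m by simp
  note Zm[measurable] = Z[OF m]
  have IH: "integrable M (\<lambda>\<omega>. (?S \<omega>)\<^sup>2)" "expectation (\<lambda>\<omega>. (?S \<omega>)\<^sup>2) =
      expectation (\<lambda>\<omega>. \<Sum>i<m. (Z i \<omega>)\<^sup>2 * (\<tau> (Suc i) - \<tau> i))"
    using Suc by auto
  \<comment> \<open>\<open>?S\<close> need not be bounded, but it is square integrable by the
    induction hypothesis, and \<open>\<bar>x * y\<bar> \<le> x\<^sup>2 + y\<^sup>2\<close>.\<close>
  have "integrable M (\<lambda>\<omega>. ?S \<omega> * Z m \<omega>)"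
  proof (rule Bochner_Integration.integrable_bound[OF Bochner_Integration.integrable_add[OF IH(1) bsq[OF m]]])
    show "(\<lambda>\<omega>. ?S \<omega> * Z m \<omega>) \<in> borel_measurable M"
      by (rule measurable_F[of _ "\<tau> m"]) measurable
    have "\<bar>x * y\<bar> \<le> x\<^sup>2 + y\<^sup>2" for x y :: real
      using sum_squares_bound[of "\<bar>x\<bar>" "\<bar>y\<bar>"] mult_nonneg_nonneg[of "\<bar>x\<bar>" "\<bar>y\<bar>"]
      unfolding abs_mult power2_abs by linarith
    then show "AE \<omega> in M. norm (?S \<omega> * Z m \<omega>) \<le> norm ((?S \<omega>)\<^sup>2 + (Z m \<omega>)\<^sup>2)" by simp
  qed
  note x = increment_mult[OF t _ this] and y = increment_mult[OF t _ bsq[OF m]]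
  have sq: "(simple_integral B (Suc m) \<tau> Z \<omega>)\<^sup>2 =
      (?S \<omega>)\<^sup>2 + (2 * (?S \<omega> * Z m \<omega> * ?D \<omega>) + (Z m \<omega>)\<^sup>2 * (?D \<omega>)\<^sup>2)" for \<omega>
    by (simp add: simple_integral_def power2_eq_square algebra_simps)
  have "integrable M (\<lambda>\<omega>. (simple_integral B (Suc m) \<tau> Z \<omega>)\<^sup>2)"
    unfolding sq using IH(1) x(1) y(3) by (intro Bochner_Integration.integrable_add integrable_mult_right) auto
  moreover have "expectation (\<lambda>\<omega>. (simple_integral B (Suc m) \<tau> Z \<omega>)\<^sup>2) =
      expectation (\<lambda>\<omega>. (?S \<omega>)\<^sup>2) + (\<tau> (Suc m) - \<tau> m) * expectation (\<lambda>\<omega>. (Z m \<omega>)\<^sup>2)"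
    unfolding sq using IH(1) x(1,2) y(3,4) by simp
  moreover have "integrable M (\<lambda>\<omega>. \<Sum>i<m. (Z i \<omega>)\<^sup>2 * (\<tau> (Suc i) - \<tau> i))"
    using bsq m by (intro Bochner_Integration.integrable_sum) auto
  ultimately show ?case
    using IH(2) bsq[OF m] by (simp add: mult.commute)
qed

end

text \<open>Partial sums of nonnegative terms increase, so the terms kept form an initial segment,
  whose total is a partial sum that passed the test (or an empty sum).\<close>

lemma sum_truncated_le:
  fixes q :: "nat \<Rightarrow> real"
  assumes "\<And>i. i < k \<Longrightarrow> 0 \<le> q i" "0 \<le> \<delta>"
  shows "(\<Sum>i<k. if (\<Sum>j\<le>i. q j) \<le> \<delta> then q i else 0) \<le> \<delta>"
  using assms(1)
proof (induction k)
  case 0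
  then show ?case using assms(2) by simp
next
  case (Suc k)
  show ?case
  proof (cases "(\<Sum>j\<le>k. q j) \<le> \<delta>")
    case True
    have "(\<Sum>i<Suc k. if (\<Sum>j\<le>i. q j) \<le> \<delta> then q i else 0) \<le> (\<Sum>i<Suc k. q i)"
      using Suc.prems by (intro sum_mono) auto
    then show ?thesis using True by (simp add: lessThan_Suc_atMost)
  next
    case False
    then show ?thesis using Suc by simp
  qed
qed

text \<open>The half-open intervals of a monotone partition are disjoint, so squaring the step
  function produces no cross terms.\<close>

lemma simple_process_square_integral:
  assumes \<tau>: "\<tau> 0 = 0" "\<tau> k = t" "mono_on {..k} \<tau>"
  shows "(\<integral>\<^sup>+ s\<in>{0..t}. ennreal ((simple_process k \<tau> \<xi> s \<omega>)\<^sup>2) \<partial>lborel) =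
    ennreal (\<Sum>i<k. (\<xi> i \<omega>)\<^sup>2 * (\<tau> (Suc i) - \<tau> i))"
proof -
  have m: "\<tau> i \<le> \<tau> j" if "i \<le> j" "j \<le> k" for i j
    using \<tau>(3) that by (auto simp: mono_on_def)
  have sq: "(simple_process k \<tau> \<xi> s \<omega>)\<^sup>2 = (\<Sum>i<k. (\<xi> i \<omega>)\<^sup>2 * indicator {\<tau> i<..\<tau> (Suc i)} s)" for s
  proof (cases "\<exists>i<k. s \<in> {\<tau> i<..\<tau> (Suc i)}")
    case True
    then obtain i where i: "i < k" "s \<in> {\<tau> i<..\<tau> (Suc i)}" by blast
    have uniq: "j = i" if "j < k" "s \<in> {\<tau> j<..\<tau> (Suc j)}" for j
      using i that m[of "Suc i" j] m[of "Suc j" i] by (cases j i rule: linorder_cases) auto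
    have *: "indicator {\<tau> j<..\<tau> (Suc j)} s = (if j = i then 1 else 0::real)" if "j < k" for j
    proof (cases "j = i")
      case True
      then show ?thesis using i by simp
    next
      case False
      then have "s \<notin> {\<tau> j<..\<tau> (Suc j)}" using uniq[OF that] by blast
      then show ?thesis using False by (simp del: greaterThanAtMost_iff)
    qed
    have "simple_process k \<tau> \<xi> s \<omega> = (\<Sum>j<k. if j = i then \<xi> j \<omega> else 0)"
      unfolding simple_process_def by (intro sum.cong refl) (simp add: *)
    moreover have "(\<Sum>j<k. (\<xi> j \<omega>)\<^sup>2 * indicator {\<tau> j<..\<tau> (Suc j)} s) =
        (\<Sum>j<k. if j = i then (\<xi> j \<omega>)\<^sup>2 else 0)"
      by (intro sum.cong refl) (simp add: *)
    ultimately show ?thesis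
      using i by simp
  next
    case False
    then have "indicator {\<tau> j<..\<tau> (Suc j)} s = (0::real)" if "j < k" for j
      using that by (simp del: greaterThanAtMost_iff)
    then show ?thesis unfolding simple_process_def by simp
  qed
  have "(\<integral>\<^sup>+ s\<in>{0..t}. ennreal ((simple_process k \<tau> \<xi> s \<omega>)\<^sup>2) \<partial>lborel) =
      (\<integral>\<^sup>+ s. (\<Sum>i<k. ennreal ((\<xi> i \<omega>)\<^sup>2) * indicator {\<tau> i<..\<tau> (Suc i)} s) \<partial>lborel)"
  proof (rule nn_integral_cong)
    fix s :: real
    have out: "indicator {\<tau> i<..\<tau> (Suc i)} s = (0::ennreal)" if "s \<notin> {0..t}" "i < k" for i
      using that m[of 0 i] m[of "Suc i" k] \<tau> by (auto simp: indicator_def)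
    have "ennreal ((simple_process k \<tau> \<xi> s \<omega>)\<^sup>2) =
        (\<Sum>i<k. ennreal ((\<xi> i \<omega>)\<^sup>2 * indicator {\<tau> i<..\<tau> (Suc i)} s))"
      unfolding sq by (rule sum_ennreal[symmetric]) simp
    also have "\<dots> = (\<Sum>i<k. ennreal ((\<xi> i \<omega>)\<^sup>2) * indicator {\<tau> i<..\<tau> (Suc i)} s)"
      by (intro sum.cong refl) (simp add: indicator_def)
    finally show "ennreal ((simple_process k \<tau> \<xi> s \<omega>)\<^sup>2) * indicator {0..t} s =
        (\<Sum>i<k. ennreal ((\<xi> i \<omega>)\<^sup>2) * indicator {\<tau> i<..\<tau> (Suc i)} s)"
      using out by (cases "s \<in> {0..t}") simp_all
  qed
  also have "\<dots> = (\<Sum>i<k. ennreal ((\<xi> i \<omega>)\<^sup>2) * ennreal (\<tau> (Suc i) - \<tau> i))"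
    by (subst nn_integral_sum) (auto simp: nn_integral_cmult_indicator m)
  also have "\<dots> = (\<Sum>i<k. ennreal ((\<xi> i \<omega>)\<^sup>2 * (\<tau> (Suc i) - \<tau> i)))"
    by (simp add: ennreal_mult m)
  also have "\<dots> = ennreal (\<Sum>i<k. (\<xi> i \<omega>)\<^sup>2 * (\<tau> (Suc i) - \<tau> i))"
    by (rule sum_ennreal) (simp add: m)
  finally show ?thesis .
qed

context real_wiener
begin

text \<open>
  Setting the integrand to zero once its accumulated energy exceeds \<open>\<delta>\<close> keeps it adapted, because
  the energy on the \<open>i\<close>-th interval is already known at time \<open>\<tau> i\<close>.
\<close>

lemma simple_integral_tail:
  assumes s: "simple_integrand F t k \<tau> \<xi>" and "0 < \<epsilon>" "0 \<le> \<delta>"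
  shows "prob {\<omega>\<in>space M. \<epsilon> < \<bar>simple_integral B k \<tau> \<xi> \<omega>\<bar>} \<le>
    \<delta> / \<epsilon>\<^sup>2 + prob {\<omega>\<in>space M. \<delta> < (\<Sum>i<k. (\<xi> i \<omega>)\<^sup>2 * (\<tau> (Suc i) - \<tau> i))}"
proof -
  define q where "q i \<omega> = (\<xi> i \<omega>)\<^sup>2 * (\<tau> (Suc i) - \<tau> i)" for i \<omega>
  \<comment> \<open>Including \<open>j = i\<close> also drops the interval that would cross the
    level, so the energy of \<open>Z\<close> stays below \<open>\<delta>\<close> without an
    overshoot.\<close>
  define Z where "Z i \<omega> = (if (\<Sum>j\<le>i. q j \<omega>) \<le> \<delta> then \<xi> i \<omega> else 0)" for i \<omega>
  have \<tau>: "mono_on {..k} \<tau>" "0 \<le> \<tau> 0"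
    and \<xi>: "\<And>i. i < k \<Longrightarrow> \<xi> i \<in> borel_measurable (F (\<tau> i))"
    and bnd: "\<And>i. i < k \<Longrightarrow> \<exists>C. \<forall>\<omega>\<in>space M. \<bar>\<xi> i \<omega>\<bar> \<le> C"
    using s subalgebra by (auto simp: simple_integrand_def subalgebra_def)
  have m: "\<tau> i \<le> \<tau> j" if "i \<le> j" "j \<le> k" for i j
    using \<tau>(1) that by (auto simp: mono_on_def)
  have q0: "0 \<le> q i \<omega>" if "i < k" for i \<omega>
    using m[of i "Suc i"] that by (simp add: q_def)
  have qm: "q j \<in> borel_measurable (F (\<tau> i))" if "j \<le> i" "i < k" for i j
    using measurable_F_mono[OF m[OF that(1)] \<xi>[of j]] that
    unfolding q_def[abs_def] by (intro borel_measurable_times borel_measurable_power) auto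
  have Zm: "Z i \<in> borel_measurable (F (\<tau> i))" if "i < k" for i
  proof -
    have [measurable]: "(\<lambda>\<omega>. \<Sum>j\<le>i. q j \<omega>) \<in> borel_measurable (F (\<tau> i))"
      using qm that by (intro borel_measurable_sum) auto
    note [measurable] = \<xi>[OF that]
    show ?thesis unfolding Z_def[abs_def] by measurable
  qed
  have Zb: "\<exists>C. \<forall>\<omega>\<in>space M. \<bar>Z i \<omega>\<bar> \<le> C" if i: "i < k" for i
  proof -
    obtain C where C: "\<forall>\<omega>\<in>space M. \<bar>\<xi> i \<omega>\<bar> \<le> C" using bnd[OF i] by blast
    then have "\<forall>\<omega>\<in>space M. \<bar>Z i \<omega>\<bar> \<le> C"
      by (metis Z_def abs_ge_zero abs_zero order_trans)
    then show ?thesis by blast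
  qed
  let ?S = "simple_integral B k \<tau> Z"
  note M2 = simple_integral_second_moment[of k \<tau> Z k, OF \<tau> Zm Zb order_refl]
  have e: "(Z i \<omega>)\<^sup>2 * (\<tau> (Suc i) - \<tau> i) = (if (\<Sum>j\<le>i. q j \<omega>) \<le> \<delta> then q i \<omega> else 0)" for i \<omega>
    by (simp add: Z_def q_def)
  have le: "(\<Sum>i<k. (Z i \<omega>)\<^sup>2 * (\<tau> (Suc i) - \<tau> i)) \<le> \<delta>" for \<omega>
    unfolding e by (rule sum_truncated_le) (use q0 \<open>0 \<le> \<delta>\<close> in auto)
  have "expectation (\<lambda>\<omega>. (?S \<omega>)\<^sup>2) = expectation (\<lambda>\<omega>. \<Sum>i<k. (Z i \<omega>)\<^sup>2 * (\<tau> (Suc i) - \<tau> i))"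
    using M2 by auto
  also have "\<dots> \<le> \<delta>"
  proof (rule integral_le_const)
    have Zk: "Z i \<in> borel_measurable M" if "i < k" for i
      using measurable_F[OF Zm[OF that]] .
    have meas: "(\<lambda>\<omega>. \<Sum>i<k. (Z i \<omega>)\<^sup>2 * (\<tau> (Suc i) - \<tau> i)) \<in> borel_measurable M"
      using Zk by (intro borel_measurable_sum borel_measurable_times borel_measurable_power) auto
    have "0 \<le> (\<Sum>i<k. (Z i \<omega>)\<^sup>2 * (\<tau> (Suc i) - \<tau> i))" for \<omega>
      using m by (intro sum_nonneg) simp
    then show "integrable M (\<lambda>\<omega>. \<Sum>i<k. (Z i \<omega>)\<^sup>2 * (\<tau> (Suc i) - \<tau> i))"
      using le meas by (intro integrable_const_bound[of _ \<delta>]) auto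
  qed (simp add: le)
  finally have E: "expectation (\<lambda>\<omega>. (?S \<omega>)\<^sup>2) \<le> \<delta>" .
  have Sm[measurable]: "?S \<in> borel_measurable M"
    by (rule measurable_F[OF simple_integral_measurable[OF \<tau> Zm order_refl]])
  have qM: "(\<lambda>\<omega>. \<Sum>i<k. q i \<omega>) \<in> borel_measurable M"
    using measurable_F[OF qm[OF order_refl]] by (intro borel_measurable_sum) auto
  \<comment> \<open>Chebyshev's inequality handles the truncated integral; the event that truncation
    took effect is the second term of the claimed bound.\<close>
  have "prob {\<omega>\<in>space M. \<epsilon>\<^sup>2 \<le> (?S \<omega>)\<^sup>2} \<le> expectation (\<lambda>\<omega>. (?S \<omega>)\<^sup>2) / \<epsilon>\<^sup>2"
    using M2 \<open>0 < \<epsilon>\<close> by (intro integral_Markov_inequality_measure[where A = "{}"]) auto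
  also have "\<dots> \<le> \<delta> / \<epsilon>\<^sup>2"
    using E \<open>0 < \<epsilon>\<close> by (intro divide_right_mono) auto
  finally have c: "prob {\<omega>\<in>space M. \<epsilon>\<^sup>2 \<le> (?S \<omega>)\<^sup>2} \<le> \<delta> / \<epsilon>\<^sup>2" .
  have agree: "?S \<omega> = simple_integral B k \<tau> \<xi> \<omega>" if "(\<Sum>i<k. q i \<omega>) \<le> \<delta>" for \<omega>
  proof -
    have "(\<Sum>j\<le>i. q j \<omega>) \<le> \<delta>" if "i < k" for i
      using sum_mono2[of "{..<k}" "{..i}" "\<lambda>i. q i \<omega>"] q0 that \<open>(\<Sum>i<k. q i \<omega>) \<le> \<delta>\<close> by force
    then show ?thesis
      unfolding simple_integral_def by (intro sum.cong) (auto simp: Z_def)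
  qed
  have "{\<omega>\<in>space M. \<epsilon> < \<bar>simple_integral B k \<tau> \<xi> \<omega>\<bar>} \<subseteq>
      {\<omega>\<in>space M. \<epsilon>\<^sup>2 \<le> (?S \<omega>)\<^sup>2} \<union> {\<omega>\<in>space M. \<delta> < (\<Sum>i<k. q i \<omega>)}"
    using agree \<open>0 < \<epsilon>\<close> by (force simp: not_less abs_le_square_iff[symmetric])
  then have "prob {\<omega>\<in>space M. \<epsilon> < \<bar>simple_integral B k \<tau> \<xi> \<omega>\<bar>} \<le>
      prob ({\<omega>\<in>space M. \<epsilon>\<^sup>2 \<le> (?S \<omega>)\<^sup>2} \<union> {\<omega>\<in>space M. \<delta> < (\<Sum>i<k. q i \<omega>)})"
    using qM by (intro finite_measure_mono) auto
  also have "\<dots> \<le> prob {\<omega>\<in>space M. \<epsilon>\<^sup>2 \<le> (?S \<omega>)\<^sup>2} + prob {\<omega>\<in>space M. \<delta> < (\<Sum>i<k. q i \<omega>)}"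
    using qM by (intro measure_Un_le) auto
  finally show ?thesis using c by (simp add: q_def)
qed

text \<open>For a vanishing integrand the approximants have energy tending to 0 in probability. By
  \<open>simple_integral_tail\<close> their integrals then tend to 0 in probability, and such limits
  are almost surely unique.\<close>

lemma ito_integral_zero:
  assumes I: "ito_integral M F B H t I" and H: "AE \<omega> in M. \<forall>s\<in>{0..t}. H s \<omega> = 0"
  shows "AE \<omega> in M. I \<omega> = 0"
proof -
  obtain k \<tau> \<xi> where s: "\<And>n. simple_integrand F t (k n) (\<tau> n) (\<xi> n)"
    and c1: "\<And>\<epsilon>. 0 < \<epsilon> \<Longrightarrow> (\<lambda>n. prob {\<omega>\<in>space M. ennreal \<epsilon> <
       (\<integral>\<^sup>+ s\<in>{0..t}. ennreal ((simple_process (k n) (\<tau> n) (\<xi> n) s \<omega> - H s \<omega>)\<^sup>2) \<partial>lborel)}) \<longlonglongrightarrow> 0"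
    and c2: "\<And>\<epsilon>. 0 < \<epsilon> \<Longrightarrow> (\<lambda>n. prob {\<omega>\<in>space M.
       \<epsilon> < \<bar>simple_integral B (k n) (\<tau> n) (\<xi> n) \<omega> - I \<omega>\<bar>}) \<longlonglongrightarrow> 0"
    using I unfolding ito_integral_def by blast
  have Hm: "(\<lambda>(s, \<omega>). H s \<omega>) \<in> borel_measurable (restrict_space borel {0..t} \<Otimes>\<^sub>M M)"
    and Im[measurable]: "I \<in> borel_measurable M"
    using I by (auto simp: ito_integral_def)
  have \<xi>: "\<xi> n i \<in> borel_measurable M" if "i < k n" for n i
    using s[of n] that by (auto simp: simple_integrand_def intro: measurable_F)
  have \<tau>: "\<tau> n 0 = 0" "\<tau> n (k n) = t" "mono_on {..k n} (\<tau> n)" for n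
    using s[of n] by (auto simp: simple_integrand_def)
  define R where "R = restrict_space lborel {0..t}"
  have R: "sigma_finite_measure R"
    unfolding R_def by (rule sigma_finite_measure_restrict_space) (auto intro: lborel.sigma_finite_measure_axioms)
  \<comment> \<open>A non-measurable set has \<open>prob\<close> 0 by convention, so convergence of
    these probabilities carries information only once the energy is known to be measurable.
    Tonelli's theorem gives this from joint measurability.\<close>
  have meas: "(\<lambda>\<omega>. \<integral>\<^sup>+ s\<in>{0..t}. ennreal ((simple_process (k n) (\<tau> n) (\<xi> n) s \<omega> - H s \<omega>)\<^sup>2) \<partial>lborel)
      \<in> borel_measurable M" for n
  proof -
    have sR: "sets (R \<Otimes>\<^sub>M M) = sets (restrict_space borel {0..t} \<Otimes>\<^sub>M M)"
      unfolding R_def by (intro sets_pair_measure_cong sets_restrict_space_cong) auto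
    have [measurable]: "(\<lambda>x. H (fst x) (snd x)) \<in> borel_measurable (R \<Otimes>\<^sub>M M)"
      using Hm by (simp add: measurable_cong_sets[OF sR refl] case_prod_beta)
    have fR: "(\<lambda>x. fst x) \<in> borel_measurable (R \<Otimes>\<^sub>M M)"
    proof -
      have "(\<lambda>x. x) \<in> borel_measurable R"
        unfolding R_def by (rule measurable_restrict_space1) simp
      then show ?thesis by measurable
    qed
    note [measurable] = fR
    have "(\<lambda>x. simple_process (k n) (\<tau> n) (\<xi> n) (fst x) (snd x)) \<in> borel_measurable (R \<Otimes>\<^sub>M M)"
      unfolding simple_process_def
    proof (rule borel_measurable_sum)
      fix i assume "i \<in> {..<k n}"
      then have [measurable]: "\<xi> n i \<in> borel_measurable M" using \<xi> by simp
      show "(\<lambda>x. \<xi> n i (snd x) * indicator {\<tau> n i<..\<tau> n (Suc i)} (fst x))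
          \<in> borel_measurable (R \<Otimes>\<^sub>M M)" by measurable
    qed
    then have "(\<lambda>x. ennreal ((simple_process (k n) (\<tau> n) (\<xi> n) (fst x) (snd x) - H (fst x) (snd x))\<^sup>2))
        \<in> borel_measurable (R \<Otimes>\<^sub>M M)" by measurable
    from measurable_pair_swap[OF this]
    have "(\<lambda>\<omega>. \<integral>\<^sup>+ s. ennreal ((simple_process (k n) (\<tau> n) (\<xi> n) s \<omega> - H s \<omega>)\<^sup>2) \<partial>R)
      \<in> borel_measurable M"
      by (intro sigma_finite_measure.borel_measurable_nn_integral[OF R]) (simp add: case_prod_beta)
    then show ?thesis by (simp add: R_def nn_integral_restrict_space)
  qed
  \<comment> \<open>One \<open>\<epsilon>\<close> pays for the approximation error, the other for
    the simple integral. Here \<open>n\<close> tends to infinity with \<open>\<delta>\<close> fixed;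
    \<open>\<delta>\<close> is made small only afterwards.\<close>
  have key: "prob {\<omega>\<in>space M. 2 * \<epsilon> < \<bar>I \<omega>\<bar>} \<le> \<delta> / \<epsilon>\<^sup>2" if "0 < \<epsilon>" "0 < \<delta>" for \<epsilon> \<delta>
  proof -
    define a where "a n = prob {\<omega>\<in>space M. ennreal \<delta> <
       (\<integral>\<^sup>+ s\<in>{0..t}. ennreal ((simple_process (k n) (\<tau> n) (\<xi> n) s \<omega> - H s \<omega>)\<^sup>2) \<partial>lborel)}" for n
    define b where "b n = prob {\<omega>\<in>space M.
       \<epsilon> < \<bar>simple_integral B (k n) (\<tau> n) (\<xi> n) \<omega> - I \<omega>\<bar>}" for n
    have le: "prob {\<omega>\<in>space M. 2 * \<epsilon> < \<bar>I \<omega>\<bar>} \<le> b n + (\<delta> / \<epsilon>\<^sup>2 + a n)" for n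
    proof -
      let ?S = "simple_integral B (k n) (\<tau> n) (\<xi> n)"
      have Sm[measurable]: "?S \<in> borel_measurable M"
        using s[of n] by (intro measurable_F[OF simple_integral_measurable[of "k n"]])
          (auto simp: simple_integrand_def)
      have "prob {\<omega>\<in>space M. 2 * \<epsilon> < \<bar>I \<omega>\<bar>} \<le>
          prob ({\<omega>\<in>space M. \<epsilon> < \<bar>?S \<omega> - I \<omega>\<bar>} \<union> {\<omega>\<in>space M. \<epsilon> < \<bar>?S \<omega>\<bar>})"
        by (intro finite_measure_mono) auto
      also have "\<dots> \<le> b n + prob {\<omega>\<in>space M. \<epsilon> < \<bar>?S \<omega>\<bar>}"
        unfolding b_def by (intro measure_Un_le) auto
      also have "prob {\<omega>\<in>space M. \<epsilon> < \<bar>?S \<omega>\<bar>} \<le> \<delta> / \<epsilon>\<^sup>2 +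
          prob {\<omega>\<in>space M. \<delta> < (\<Sum>i<k n. (\<xi> n i \<omega>)\<^sup>2 * (\<tau> n (Suc i) - \<tau> n i))}"
        using simple_integral_tail[OF s] that by simp
      also have "prob {\<omega>\<in>space M. \<delta> < (\<Sum>i<k n. (\<xi> n i \<omega>)\<^sup>2 * (\<tau> n (Suc i) - \<tau> n i))} \<le> a n"
        unfolding a_def
      proof (rule finite_measure_mono_AE)
        show "AE \<omega> in M. \<omega> \<in> {\<omega>\<in>space M. \<delta> < (\<Sum>i<k n. (\<xi> n i \<omega>)\<^sup>2 * (\<tau> n (Suc i) - \<tau> n i))} \<longrightarrow>
          \<omega> \<in> {\<omega>\<in>space M. ennreal \<delta> <
           (\<integral>\<^sup>+ s\<in>{0..t}. ennreal ((simple_process (k n) (\<tau> n) (\<xi> n) s \<omega> - H s \<omega>)\<^sup>2) \<partial>lborel)}"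
          using H
        proof eventually_elim
          fix \<omega> assume H0: "\<forall>s\<in>{0..t}. H s \<omega> = 0"
          have "(\<integral>\<^sup>+ s\<in>{0..t}. ennreal ((simple_process (k n) (\<tau> n) (\<xi> n) s \<omega> - H s \<omega>)\<^sup>2) \<partial>lborel) =
              (\<integral>\<^sup>+ s\<in>{0..t}. ennreal ((simple_process (k n) (\<tau> n) (\<xi> n) s \<omega>)\<^sup>2) \<partial>lborel)"
            using H0 by (intro nn_integral_cong) (auto simp: indicator_def)
          also have "\<dots> = ennreal (\<Sum>i<k n. (\<xi> n i \<omega>)\<^sup>2 * (\<tau> n (Suc i) - \<tau> n i))"
            by (rule simple_process_square_integral[OF \<tau>])
          finally show "\<omega> \<in> {\<omega>\<in>space M. \<delta> < (\<Sum>i<k n. (\<xi> n i \<omega>)\<^sup>2 * (\<tau> n (Suc i) - \<tau> n i))} \<longrightarrow>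
          \<omega> \<in> {\<omega>\<in>space M. ennreal \<delta> <
           (\<integral>\<^sup>+ s\<in>{0..t}. ennreal ((simple_process (k n) (\<tau> n) (\<xi> n) s \<omega> - H s \<omega>)\<^sup>2) \<partial>lborel)}"
            using that by (auto simp: ennreal_less_iff)
        qed
      qed (use meas in measurable)
      finally show ?thesis by simp
    qed
    have "(\<lambda>n. b n + (\<delta> / \<epsilon>\<^sup>2 + a n)) \<longlonglongrightarrow> 0 + (\<delta> / \<epsilon>\<^sup>2 + 0)"
      using c1[OF that(2)] c2[OF that(1)] unfolding a_def b_def by (intro tendsto_intros)
    then have "prob {\<omega>\<in>space M. 2 * \<epsilon> < \<bar>I \<omega>\<bar>} \<le> 0 + (\<delta> / \<epsilon>\<^sup>2 + 0)"
      by (rule LIMSEQ_le_const) (use le in blast)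
    then show ?thesis by simp
  qed
  have "AE \<omega> in M. \<bar>I \<omega>\<bar> \<le> 2 * inverse (real (Suc n))" for n
  proof -
    let ?\<epsilon> = "inverse (real (Suc n))"
    \<comment> \<open>The choice \<open>\<delta> = e * ?\<epsilon>\<^sup>2\<close> turns the bound
      into \<open>e\<close>.\<close>
    have "prob {\<omega>\<in>space M. 2 * ?\<epsilon> < \<bar>I \<omega>\<bar>} \<le> 0 + e" if "0 < e" for e
      using key[of ?\<epsilon> "e * ?\<epsilon>\<^sup>2"] that by (simp del: of_nat_Suc)
    then have "prob {\<omega>\<in>space M. 2 * ?\<epsilon> < \<bar>I \<omega>\<bar>} \<le> 0"
      by (rule field_le_epsilon)
    then have "emeasure M {\<omega>\<in>space M. \<not> \<bar>I \<omega>\<bar> \<le> 2 * ?\<epsilon>} = 0"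
      by (simp add: emeasure_eq_measure not_le measure_le_0_iff)
    then show ?thesis
      by (subst AE_iff_measurable[OF _ refl]) measurable
  qed
  then have "AE \<omega> in M. \<forall>n. \<bar>I \<omega>\<bar> \<le> 2 * inverse (real (Suc n))"
    by (simp add: AE_all_countable)
  then show ?thesis
  proof eventually_elim
    fix \<omega> assume *: "\<forall>n. \<bar>I \<omega>\<bar> \<le> 2 * inverse (real (Suc n))"
    have "(\<lambda>n. 2 * inverse (real (Suc n))) \<longlonglongrightarrow> 2 * 0"
      by (intro tendsto_intros LIMSEQ_inverse_real_of_nat)
    then have "\<bar>I \<omega>\<bar> \<le> 2 * 0"
      by (rule LIMSEQ_le_const) (use * in blast)
    then show "I \<omega> = 0" by simp
  qed
qed

end

text \<open>A marginal of a product density: Tonelli splits the integral over the coordinates, and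
  all factors except that of \<open>l\<close> integrate to 1.\<close>

lemma distributed_vec_component:
  fixes X :: "'w \<Rightarrow> real^'d"
  assumes g: "prob_space (density lborel g)" "\<And>x. 0 \<le> g x" and [measurable]: "g \<in> borel_measurable borel"
    and X: "distributed M lborel X (\<lambda>x. ennreal (\<Prod>l\<in>UNIV. g (x $ l)))"
  shows "distributed M lborel (\<lambda>\<omega>. X \<omega> $ l) (\<lambda>x. ennreal (g x))"
proof -
  have Xm[measurable]: "X \<in> borel_measurable M"
    using distributed_measurable[OF X] by simp
  have Xl[measurable]: "(\<lambda>\<omega>. X \<omega> $ l) \<in> borel_measurable M"
    by (simp add: cart_eq_inner_axis)
  have [measurable]: "(\<lambda>x::real^'d. x $ l) \<in> borel_measurable borel" for l
    by (simp add: cart_eq_inner_axis)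
  have g1: "(\<integral>\<^sup>+ x. ennreal (g x) \<partial>lborel) = 1"
    using prob_space.emeasure_space_1[OF g(1)] by (simp add: emeasure_density)
  let ?e = "axis l 1 :: real^'d"
  have e: "?e \<in> Basis" by (simp add: axis_in_Basis_iff)
  have "distr M lborel (\<lambda>\<omega>. X \<omega> $ l) = density lborel (\<lambda>x. ennreal (g x))"
  proof (rule measure_eqI)
    fix A assume "A \<in> sets (distr M lborel (\<lambda>\<omega>. X \<omega> $ l))"
    then have A[measurable]: "A \<in> sets borel" by simp
    \<comment> \<open>The indicator of \<open>A\<close> goes into the factor of the basis vector for
      \<open>l\<close>, which keeps the integrand a product over \<open>Basis\<close>.\<close>
    define f :: "real^'d \<Rightarrow> real \<Rightarrow> real"
      where "f b y = (if b = ?e then indicator A y else 1) * g y" for b y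
    have split: "(\<Prod>b\<in>Basis. f b (x \<bullet> b)) = indicator A (x $ l) * (\<Prod>l\<in>UNIV. g (x $ l))" for x
    proof -
      have "(\<Prod>b\<in>Basis. g (x \<bullet> b)) = (\<Prod>l\<in>UNIV. g (x $ l))"
        using prod.reindex[of "\<lambda>l. axis l 1 :: real^'d" UNIV "\<lambda>b. g (x \<bullet> b)"]
        by (simp add: Basis_vec_def inj_on_def axis_eq_axis cart_eq_inner_axis UNION_singleton_eq_range)
      moreover have "(\<Prod>b\<in>Basis. if b = ?e then indicator A (x \<bullet> b) else 1) = (indicator A (x $ l) :: real)"
        using e by (simp add: prod.delta cart_eq_inner_axis)
      ultimately show ?thesis
        unfolding f_def prod.distrib by simp
    qed
    have "emeasure (distr M lborel (\<lambda>\<omega>. X \<omega> $ l)) A = emeasure (distr M lborel X) {x. x $ l \<in> A}"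
      by (subst (1 2) emeasure_distr) (auto simp: intro!: arg_cong[where f = "emeasure M"])
    also have "\<dots> = (\<integral>\<^sup>+ x. ennreal (\<Prod>l\<in>UNIV. g (x $ l)) * indicator {x. x $ l \<in> A} x \<partial>lborel)"
      unfolding distributed_distr_eq_density[OF X] by (rule emeasure_density) auto
    also have "\<dots> = (\<integral>\<^sup>+ x. ennreal (\<Prod>b\<in>Basis. f b (x \<bullet> b)) \<partial>lborel)"
      unfolding split by (intro nn_integral_cong) (auto simp: indicator_def)
    also have "\<dots> = (\<integral>\<^sup>+ x. (\<Prod>b\<in>Basis. ennreal (f b (x \<bullet> b))) \<partial>lborel)"
      by (subst prod_ennreal) (auto simp: f_def g)
    also have "\<dots> = (\<Prod>b\<in>Basis. \<integral>\<^sup>+ y. ennreal (f b y) \<partial>lborel)"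
      by (rule nn_integral_lborel_prod) (auto simp: f_def[abs_def] g)
    also have "\<dots> = (\<Prod>b\<in>Basis. if b = ?e then \<integral>\<^sup>+ y. ennreal (g y) * indicator A y \<partial>lborel else 1)"
      by (intro prod.cong refl)
        (auto simp: f_def g1 indicator_def intro!: nn_integral_cong)
    also have "\<dots> = (\<integral>\<^sup>+ y. ennreal (g y) * indicator A y \<partial>lborel)"
      using e by (simp add: prod.delta)
    also have "\<dots> = emeasure (density lborel (\<lambda>x. ennreal (g x))) A"
      by (rule emeasure_density[symmetric]) auto
    finally show "emeasure (distr M lborel (\<lambda>\<omega>. X \<omega> $ l)) A = \<dots>" .
  qed simp
  then show ?thesis by (simp add: distributed_def)
qed

text \<open>\<open>wiener_process\<close> speaks of the vector increment only; coordinates inherit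
  its law as a marginal and its independence through a smaller family of events.\<close>

lemma wiener_process_component:
  fixes W :: "real \<Rightarrow> 'w \<Rightarrow> real^'d"
  assumes F: "filtered_prob_space \<mu> F" and W: "wiener_process \<mu> F W"
  shows "real_wiener \<mu> F (\<lambda>t \<omega>. W t \<omega> $ l)"
proof -
  interpret prob_space \<mu> using F by (simp add: filtered_prob_space_def)
  have sub: "subalgebra \<mu> (F t)" for t
    using F by (simp add: filtered_prob_space_def)
  have comp: "(\<lambda>x::real^'d. x $ l) \<in> borel_measurable borel"
    by (simp add: cart_eq_inner_axis)
  have ad: "(\<lambda>\<omega>. W t \<omega> $ l) \<in> borel_measurable (F t)" if "0 \<le> t" for t
    using W measurable_compose[OF _ comp] that by (auto simp: wiener_process_def adapted_def)
  have WM: "W t \<in> borel_measurable \<mu>" if "0 \<le> t" for t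
    using W that measurable_from_subalg[OF sub] by (auto simp: wiener_process_def adapted_def)
  show ?thesis
  proof (rule real_wiener.intro[OF prob_space_axioms real_wiener_axioms.intro])
    show "filtration (space \<mu>) F"
      using F by (simp add: filtered_prob_space_def)
    show "subalgebra \<mu> (F t)" for t by (rule sub)
    show "(\<lambda>\<omega>. W t \<omega> $ l) \<in> borel_measurable (F t)" if "0 \<le> t" for t
      by (rule ad[OF that])
    show "distributed \<mu> lborel (\<lambda>\<omega>. W t \<omega> $ l - W s \<omega> $ l) (normal_density 0 (sqrt (t - s)))"
      if "0 \<le> s" "s < t" for s t
      using distributed_vec_component[of "normal_density 0 (sqrt (t - s))" \<mu> "\<lambda>\<omega>. W t \<omega> - W s \<omega>" l]
        prob_space_normal_density[of "sqrt (t - s)"] W that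
      by (auto simp: wiener_process_def)
    show "indep_var borel Z borel (\<lambda>\<omega>. W t \<omega> $ l - W s \<omega> $ l)"
      if "0 \<le> s" "s < t" and Z: "Z \<in> borel_measurable (F s)" for s t Z
    proof -
      let ?D = "\<lambda>\<omega>. W t \<omega> - W s \<omega>"
      have D[measurable]: "?D \<in> borel_measurable \<mu>"
        using WM that by auto
      have Dl: "(\<lambda>\<omega>. W t \<omega> $ l - W s \<omega> $ l) \<in> borel_measurable \<mu>"
        using measurable_compose[OF D comp] by simp
      have ind: "indep_set (sets (F s)) {?D -` A \<inter> space \<mu> | A. A \<in> sets borel}"
        using W that by (simp add: wiener_process_def)
      have "indep_set {Z -` A \<inter> space \<mu> | A. A \<in> sets borel}
          {(\<lambda>\<omega>. W t \<omega> $ l - W s \<omega> $ l) -` A \<inter> space \<mu> | A. A \<in> sets borel}"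
        using ind unfolding indep_set_def
      proof (rule indep_sets_mono_sets)
        fix i :: bool
        have "{Z -` A \<inter> space \<mu> | A. A \<in> sets borel} \<subseteq> sets (F s)"
          using measurable_sets[OF Z] sub[of s] by (auto simp: subalgebra_def)
        moreover have "{(\<lambda>\<omega>. W t \<omega> $ l - W s \<omega> $ l) -` A \<inter> space \<mu> | A. A \<in> sets borel} \<subseteq>
            {?D -` A \<inter> space \<mu> | A. A \<in> sets borel}"
        proof safe
          fix A :: "real set" assume "A \<in> sets borel"
          then have "(\<lambda>x::real^'d. x $ l) -` A \<in> sets borel"
            using measurable_sets[OF comp] by simp
          then show "\<exists>B. (\<lambda>\<omega>. W t \<omega> $ l - W s \<omega> $ l) -` A \<inter> space \<mu> = ?D -` B \<inter> space \<mu> \<and> B \<in> sets borel"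
            by (intro exI[of _ "(\<lambda>x. x $ l) -` A"]) auto
        qed
        ultimately show "case_bool {Z -` A \<inter> space \<mu> | A. A \<in> sets borel}
            {(\<lambda>\<omega>. W t \<omega> $ l - W s \<omega> $ l) -` A \<inter> space \<mu> | A. A \<in> sets borel} i \<subseteq>
          case_bool (sets (F s)) {?D -` A \<inter> space \<mu> | A. A \<in> sets borel} i"
          by (cases i) auto
      qed
      \<comment> \<open>\<open>indep_var_eq\<close> asks about generated sigma-algebras;
        independence passes to them from intersection-stable generators.\<close>
      moreover have "Int_stable {Y -` A \<inter> space \<mu> | A. A \<in> sets borel}" for Y :: "'w \<Rightarrow> real"
      proof (safe intro!: Int_stableI)
        fix A B :: "real set" assume "A \<in> sets borel" "B \<in> sets borel"
        then show "\<exists>C. (Y -` A \<inter> space \<mu>) \<inter> (Y -` B \<inter> space \<mu>) = Y -` C \<inter> space \<mu> \<and> C \<in> sets borel"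
          by (intro exI[of _ "A \<inter> B"]) auto
      qed
      ultimately show ?thesis
        unfolding indep_var_eq using measurable_from_subalg[OF sub Z] Dl
        by (intro conjI indep_set_sigma_sets) auto
    qed
  qed
qed

subsection \<open>Solutions of the constrained equation\<close>

text \<open>\<open>V\<close> is a derivation and kills the square, and the factor
  \<open>1 / 2\<close> cancels the 2 of \<open>generator_square_zero\<close>.\<close>

lemma drift_square_zero:
  fixes \<sigma> :: "'d::finite \<Rightarrow> 'm \<Rightarrow> 'm pt_op"
  assumes M: "smooth_manifold M" and G: "diffusion_generator M G"
    and x: "x \<in> points M" and V: "V x u \<in> tangent_space M x"
    and \<sigma>: "\<And>l. \<sigma> l x \<in> tangent_space M x"
    and f: "f \<in> smooth_funs M" "f x = 0"
  shows "drift_op V G \<sigma> x u (\<lambda>y. f y * f y) = (\<Sum>l\<in>UNIV. (\<sigma> l x f)\<^sup>2)"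
  unfolding drift_op_def tangent_square_zero[where x = x, OF V f]
    generator_square_zero[OF M G x \<sigma> f]
  by (simp add: sum_distrib_left[symmetric])

text \<open>A nonzero value at \<open>t\<close> would persist on some interval to the right of
  \<open>t\<close>, and that interval contains a rational. This turns a constraint given time by
  time into one valid along the whole path.\<close>

lemma cadlag_eq_zero:
  assumes \<gamma>: "cadlag T \<gamma>" and f: "continuous_map T euclideanreal f"
    and q: "\<And>r::rat. 0 \<le> real_of_rat r \<Longrightarrow> f (\<gamma> (real_of_rat r)) = 0" and "0 \<le> t"
  shows "f (\<gamma> t) = 0"
proof (rule ccontr)
  assume ne: "f (\<gamma> t) \<noteq> 0"
  have "limitin euclideanreal (f \<circ> \<gamma>) (f (\<gamma> t)) (at_right t)"
    using \<gamma> \<open>0 \<le> t\<close> by (intro continuous_map_limit[OF f]) (simp add: cadlag_def)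
  then have "((\<lambda>s. f (\<gamma> s)) \<longlongrightarrow> f (\<gamma> t)) (at_right t)"
    by (simp add: o_def)
  from tendsto_imp_eventually_ne[OF this ne] obtain b
    where b: "t < b" "\<forall>y>t. y < b \<longrightarrow> f (\<gamma> y) \<noteq> 0"
    by (auto simp: eventually_at_right_field)
  obtain r where "t < real_of_rat r" "real_of_rat r < b"
    using of_rat_dense[OF b(1)] by blast
  moreover from this have "0 \<le> real_of_rat r" using \<open>0 \<le> t\<close> by linarith
  ultimately show False using b(2) q[of r] by blast
qed

text \<open>A nonnegative function with zero integral vanishes only almost everywhere, hence the
  inner quantifier over times. In \<open>z\<close> one null set serves all times, because
  \<open>ito_integral_zero\<close> needs the integrand to vanish along the path.\<close>

lemma diffusion_coefficients_vanish:
  fixes W :: "real \<Rightarrow> 'w \<Rightarrow> real^'d"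
  assumes M: "smooth_manifold M" and G: "diffusion_generator M G"
    and V: "\<And>x u. x \<in> points M \<Longrightarrow> u \<in> points N \<Longrightarrow> V x u \<in> tangent_space M x"
    and F: "filtered_prob_space \<mu> F" and W: "wiener_process \<mu> F W"
    and \<sigma>: "\<And>l. \<sigma> l \<in> vector_fields M"
    and XU: "\<And>t \<omega>. 0 \<le> t \<Longrightarrow> \<omega> \<in> space \<mu> \<Longrightarrow> X t \<omega> \<in> points M \<and> U t \<omega> \<in> points N"
    and sde: "solves_sde \<mu> F W M V G \<sigma> X U"
    and f: "f \<in> smooth_funs M" and z: "AE \<omega> in \<mu>. \<forall>t\<ge>0. f (X t \<omega>) = 0"
    and "0 \<le> T"
  shows "AE \<omega> in \<mu>. AE s in lborel. s \<in> {0..T} \<longrightarrow> (\<forall>l. \<sigma> l (X s \<omega>) f = 0)"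
proof -
  let ?f = "\<lambda>y. f y * f y"
  have tan: "\<sigma> l x \<in> tangent_space M x" if "x \<in> points M" for l x
    using \<sigma> that by (simp add: vector_fields_def)
  have "?f \<in> smooth_funs M" by (rule smooth_funs_mult[OF M f f])
  then obtain I where
    int: "AE \<omega> in \<mu>. set_integrable lborel {0..T} (\<lambda>s. drift_op V G \<sigma> (X s \<omega>) (U s \<omega>) ?f)"
    and I: "\<And>l. ito_integral \<mu> F (\<lambda>s \<omega>. W s \<omega> $ l) (\<lambda>s \<omega>. \<sigma> l (X s \<omega>) ?f) T (I l)"
    and eq: "AE \<omega> in \<mu>. ?f (X T \<omega>) = ?f (X 0 \<omega>) +
        (LINT s:{0..T}|lborel. drift_op V G \<sigma> (X s \<omega>) (U s \<omega>) ?f) + (\<Sum>l\<in>UNIV. I l \<omega>)"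
    using sde \<open>0 \<le> T\<close> unfolding solves_sde_def by meson
  have "AE \<omega> in \<mu>. I l \<omega> = 0" for l
  proof (rule real_wiener.ito_integral_zero[OF wiener_process_component[OF F W] I])
    show "AE \<omega> in \<mu>. \<forall>s\<in>{0..T}. \<sigma> l (X s \<omega>) ?f = 0"
      using z AE_space
    proof eventually_elim
      case (elim \<omega>)
      show ?case
      proof
        fix s assume "s \<in> {0..T}"
        then have "X s \<omega> \<in> points M" "f (X s \<omega>) = 0" using XU elim by auto
        then show "\<sigma> l (X s \<omega>) ?f = 0" using tangent_square_zero[OF tan f] by blast
      qed
    qed
  qed
  then have "AE \<omega> in \<mu>. \<forall>l. I l \<omega> = 0"
    by (simp add: AE_all_countable)
  then show ?thesis
    using int eq z AE_space
  proof eventually_elim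
    case (elim \<omega>)
    let ?q = "\<lambda>s. \<Sum>l\<in>UNIV. (\<sigma> l (X s \<omega>) f)\<^sup>2"
    have d: "drift_op V G \<sigma> (X s \<omega>) (U s \<omega>) ?f = ?q s" if "s \<in> {0..T}" for s
      using that XU[of s \<omega>] elim V by (intro drift_square_zero[OF M G _ _ tan f]) auto
    \<comment> \<open>Essential for the next step: a non-integrable function also has integral 0 by
      convention.\<close>
    have i: "integrable lborel (\<lambda>s. indicator {0..T} s * ?q s)"
      using elim(2) unfolding set_integrable_def
      by (rule Bochner_Integration.integrable_cong[THEN iffD1, OF refl, rotated])
        (auto simp: d indicator_def)
    have "(LINT s:{0..T}|lborel. ?q s) = (LINT s:{0..T}|lborel. drift_op V G \<sigma> (X s \<omega>) (U s \<omega>) ?f)"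
      by (rule set_lebesgue_integral_cong) (auto simp: d)
    also have "\<dots> = 0"
      using elim \<open>0 \<le> T\<close> by simp
    finally have "(\<integral>s. indicator {0..T} s * ?q s \<partial>lborel) = 0"
      by (simp add: set_lebesgue_integral_def)
    then have "AE s in lborel. indicator {0..T} s * ?q s = 0"
      by (subst (asm) integral_nonneg_eq_0_iff_AE[OF i]) (auto simp: sum_nonneg)
    then show ?case
      by eventually_elim (auto simp: sum_nonneg_eq_0_iff)
  qed
qed

theorem corollary3p1p1:
  fixes M :: "'m mfd" and N :: "'n mfd" and P :: "'p mfd"
    and h :: "'m \<Rightarrow> 'p" and p :: 'p
    and V :: "'m \<Rightarrow> 'n \<Rightarrow> 'm pt_op"
    and G :: "'m \<Rightarrow> 'm pt_op \<Rightarrow> 'm pt_op"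
    and \<sigma> :: "'d::finite \<Rightarrow> 'm \<Rightarrow> 'm pt_op"
    and \<mu> :: "'w measure" and F :: "real \<Rightarrow> 'w measure"
    and W :: "real \<Rightarrow> 'w \<Rightarrow> real^'d"
  assumes "smooth_manifold M" and "smooth_manifold N" and "smooth_manifold P"
    and "p \<in> points P" and "smooth_map M P h"
    and "\<And>x u. x \<in> points M \<Longrightarrow> u \<in> points N \<Longrightarrow> V x u \<in> tangent_space M x"
    and "diffusion_generator M G"
    and "filtered_prob_space \<mu> F" and "wiener_process \<mu> F W"
    and "ill_posed M P h \<sigma>"
  shows "\<not> (\<exists>X U. sdae_solution \<mu> F W M N V G \<sigma> h p X U)"
proof
  note M = assms(1)
  assume "\<exists>X U. sdae_solution \<mu> F W M N V G \<sigma> h p X U"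
  then obtain X U where semi: "mfd_semimartingale \<mu> F (prod_mfd M N) (\<lambda>t \<omega>. (X t \<omega>, U t \<omega>))"
    and sde: "solves_sde \<mu> F W M V G \<sigma> X U" and h: "\<And>t. 0 \<le> t \<Longrightarrow> AE \<omega> in \<mu>. h (X t \<omega>) = p"
    unfolding sdae_solution_def by blast
  interpret prob_space \<mu> using assms(8) by (simp add: filtered_prob_space_def)
  have \<sigma>: "\<sigma> l \<in> vector_fields M" for l
    using assms(10) by (simp add: ill_posed_def)
  have top: "mtop (prod_mfd M N) = prod_topology (mtop M) (mtop N)"
    by (simp add: prod_mfd_def)
  have XU: "X t \<omega> \<in> points M \<and> U t \<omega> \<in> points N" if "0 \<le> t" "\<omega> \<in> space \<mu>" for t \<omega>
    using semi that by (auto simp: mfd_semimartingale_def top)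
  have cad: "AE \<omega> in \<mu>. cadlag (prod_topology (mtop M) (mtop N)) (\<lambda>t. (X t \<omega>, U t \<omega>))"
    using semi by (simp add: mfd_semimartingale_def top)
  define K where "K = {f \<in> smooth_funs M. \<forall>y. h y = p \<longrightarrow> f y = 0}"
  define Q where "Q = (\<lambda>(l, f). {x \<in> points M. \<sigma> l x f \<noteq> 0})"
  have "openin (mtop M) (Q (l, f))" if "f \<in> K" for l f
  proof -
    have "(\<lambda>x. \<sigma> l x f) \<in> smooth_funs M"
      using \<sigma>[of l] that by (simp add: vector_fields_def K_def)
    from openin_continuous_map_preimage[OF smooth_funs_continuous[OF M this], of "- {0}"]
    show ?thesis by (simp add: Q_def open_Compl)
  qed
  moreover have "\<exists>l. \<exists>f\<in>K. x \<in> Q (l, f)" if x: "x \<in> points M" for x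
  proof -
    obtain l where l: "\<sigma> l x \<notin> tangent_ker M P h x"
      using assms(10) x by (auto simp: ill_posed_def)
    have tan: "\<sigma> l x \<in> tangent_space M x"
      using \<sigma>[of l] x by (simp add: vector_fields_def)
    obtain g where g: "\<sigma> l x (\<lambda>y. g (h y)) \<noteq> 0"
      using l tan by (auto simp: tangent_ker_def tangent_map_def fun_eq_iff split: if_splits)
    \<comment> \<open>Tangent vectors are set to 0 on functions that are not smooth, so a nonzero
      value certifies smoothness.\<close>
    then have gh: "(\<lambda>y. g (h y)) \<in> smooth_funs M"
      using tan unfolding tangent_space_def by blast
    have "(\<lambda>y. g (h y) + - g p) \<in> K"
      using smooth_funs_add[OF M gh smooth_funs_const[of "- g p"]] by (simp add: K_def)
    moreover have "\<sigma> l x (\<lambda>y. g (h y) + - g p) \<noteq> 0"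
      using tangent_shift[OF tan gh, of "- g p"] g by simp
    ultimately show ?thesis using x by (auto simp: Q_def)
  qed
  then have "\<Union>(Q ` (UNIV \<times> K)) = points M"
    by (auto simp: Q_def)
  moreover have "Lindelof_space (mtop M)"
    using M second_countable_imp_Lindelof_space by (auto simp: smooth_manifold_def)
  ultimately have "\<exists>\<V>. countable \<V> \<and> \<V> \<subseteq> Q ` (UNIV \<times> K) \<and> \<Union>\<V> = points M"
    by (intro Lindelof_spaceD) auto
  then obtain \<V> where \<V>: "countable \<V>" "\<V> \<subseteq> Q ` (UNIV \<times> K)" "\<Union>\<V> = points M"
    by blast
  \<comment> \<open>The subcover consists of sets; null sets belong to functions, so countably many
    index pairs are chosen for it.\<close>
  obtain C where C: "countable C" "C \<subseteq> UNIV \<times> K" "\<V> = Q ` C"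
    using countable_subset_image[THEN iffD1, OF conjI[OF \<V>(1,2)]] by (elim exE conjE)
  have "AE \<omega> in \<mu>. AE s in lborel. s \<in> {0..1} \<longrightarrow> (\<forall>l. \<sigma> l (X s \<omega>) f = 0)" if f: "f \<in> K" for f
  proof (rule diffusion_coefficients_vanish[OF M assms(7,6,8,9) \<sigma> XU sde])
    show fM: "f \<in> smooth_funs M" using f by (simp add: K_def)
    have "continuous_map (prod_topology (mtop M) (mtop N)) euclideanreal (f \<circ> fst)"
      by (rule continuous_map_compose[OF continuous_map_fst smooth_funs_continuous[OF M fM]])
    note zero = cadlag_eq_zero[OF _ this]
    have "AE \<omega> in \<mu>. 0 \<le> real_of_rat r \<longrightarrow> f (X (real_of_rat r) \<omega>) = 0" for r
    proof (cases "0 \<le> real_of_rat r")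
      case True
      then show ?thesis
        using h[OF True] by eventually_elim (use f in \<open>simp add: K_def\<close>)
    qed simp
    then have "AE \<omega> in \<mu>. \<forall>r. 0 \<le> real_of_rat r \<longrightarrow> f (X (real_of_rat r) \<omega>) = 0"
      by (simp add: AE_all_countable)
    then show "AE \<omega> in \<mu>. \<forall>t\<ge>0. f (X t \<omega>) = 0"
      using cad
    proof eventually_elim
      case (elim \<omega>)
      then show ?case using zero[OF elim(2)] by auto
    qed
  qed auto
  then have "AE \<omega> in \<mu>. \<forall>c\<in>C. AE s in lborel. s \<in> {0..1} \<longrightarrow> (\<forall>l. \<sigma> l (X s \<omega>) (snd c) = 0)"
    using C by (intro AE_ball_countable[THEN iffD2]) auto
  then have "AE \<omega> in \<mu>. False"
    using AE_space
  proof eventually_elim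
    case (elim \<omega>)
    \<comment> \<open>Countability of \<open>C\<close> enters a second time, now to merge the
      exceptional sets of times of one fixed path.\<close>
    then have "AE s in lborel. \<forall>c\<in>C. s \<in> {0..1} \<longrightarrow> (\<forall>l. \<sigma> l (X s \<omega>) (snd c) = 0)"
      using C(1) by (intro AE_ball_countable[THEN iffD2]) auto
    then have "AE s in lborel. s \<notin> {0..1::real}"
    proof eventually_elim
      case (elim s)
      show ?case
      proof
        assume s: "s \<in> {0..1}"
        then have "X s \<omega> \<in> points M" using XU \<open>\<omega> \<in> space \<mu>\<close> by auto
        then obtain c where "c \<in> C" "X s \<omega> \<in> Q c" using C(3) \<V>(3) by blast
        then show False using elim s by (auto simp: Q_def)
      qed
    qed
    \<comment> \<open>No time in the unit interval is admissible, yet its length is 1; any horizon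
      of positive length would serve.\<close>
    then have "{0..1::real} \<in> null_sets lborel"
      by (subst AE_iff_null_sets) auto
    then show False by (simp add: null_sets_def)
  qed
  then show False by simp
qed

end
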